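(* Let $n\geq 1$, $\sigma\geq 1$, $\alpha\in[0,1]$, $s\geq 0$, $\kappa\in[0,1]$, and let $w_0\in H^s\cap L^{1,\kappa}$ (with values in $\mathbb{C}^3$). Let $w$ be the solution of $$w_t-B_0(-\Delta)^{\sigma/2}w-B_1(-\Delta)^{\sigma\alpha}w=0\quad (x\in\mathbb{R}^n,\ t>0),\qquad w(0,x)=w_0(x).$$ Then there is a constant $c>0$ such that, for all $t\geq 0$ and all $s_0\geq0$, $\ell\geq 0$ with $0\leq s_0+\ell\leq s$, the following estimates hold, where the implicit constants are independent of $t$ and $w_0$. If $\alpha\in[0,1/3)$: $$\|w(t,\cdot)\|_{\dot H^{s_0}}\lesssim (1+t)^{-\frac{n+2(s_0+\kappa)}{2(2\sigma-2\sigma\alpha)}}\|w_0\|_{L^{1,\kappa}}+(1+t)^{-\frac{\ell}{2\sigma(1-3\alpha)}}\|w_0\|_{H^{s_0+\ell}}+(1+t)^{-\frac{n+2s_0}{2(2\sigma-2\sigma\alpha)}}|P_{w_0}|.$$ If $\alpha\in[1/3,1/2]$: $$\|w(t,\cdot)\|_{\dot H^{s_0}}\lesssim (1+t)^{-\frac{n+2(s_0+\kappa)}{2(2\sigma-2\sigma\alpha)}}\|w_0\|_{L^{1,\kappa}}+e^{-ct}\|w_0\|_{H^{s_0}}+(1+t)^{-\frac{n+2s_0}{2(2\sigma-2\sigma\alpha)}}|P_{w_0}|.$$ If $\alpha\in(1/2,1]$: $$\|w(t,\cdot)\|_{\dot H^{s_0}}\lesssim (1+t)^{-\frac{n+2(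s_0+\kappa)}{2(6\sigma\alpha-2\sigma)}}\|w_0\|_{L^{1,\kappa}}+e^{-ct}\|w_0\|_{H^{s_0}}+(1+t)^{-\frac{n+2s_0}{2(6\sigma\alpha-2\sigma)}}|P_{w_0}|.$$
   Context: The coefficient matrices are $$B_0=\begin{pmatrix} i&0&0\\0&-i&0\\0&0&0\end{pmatrix},\qquad B_1=\begin{pmatrix}0&0&1\\0&0&1\\-\frac12&-\frac12&-1\end{pmatrix}.$$ $(-\Delta)^{\nu}$ is the Fourier multiplier with symbol $|\xi|^{2\nu}$ (the identity if $\nu=0$); the solution is understood through the Fourier transform in $x$, i.e. $\hat w_t=(B_0|\xi|^\sigma+B_1|\xi|^{2\sigma\alpha})\hat w$, $\hat w(0,\xi)=\hat w_0(\xi)$. (The system arises from $u_{tt}+\mathcal{A}u-\mathcal{A}^{\alpha}v=0$, $v_t+\mathcal{A}^{\alpha}v+\mathcal{A}^{\alpha}u_t=0$, $\mathcal{A}=(-\Delta)^\sigma$, via $w=(u_t+i(-\Delta)^{\sigma/2}u,\,u_t-i(-\Delta)^{\sigma/2}u,\,v)^{\mathrm T}$.) $H^s$ and $\dot H^s$ are the Bessel and Riesz potential spaces on $\mathbb{R}^n$ based on $L^2$. For $\kappa\ge0$, $L^{1,\kappa}$ is the space of $f\in L^1$ with $\|f\|_{L^{1,\kappa}}=\int_{\mathbb{R}^n}(1+|x|)^\kappa|f(x)|\,dx<\infty$. $P_f=\int_{\mathbb{R}^n}f(x)\,dx$. $f\lesssim g$ means $f\le Cg$ for some constant $C>0$.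 *)

theory Defs
  imports "HOL-Analysis.Analysis"
begin

text \<open>Functions on \<open>\<real>\<^sup>n\<close> with values in \<open>\<complex>\<^sup>m\<close> are taken as representatives of their classes
  modulo null sets.\<close>

definition L2 :: "((real^'n) \<Rightarrow> (complex^'m)) set" where
  "L2 = {f. f \<in> borel_measurable lebesgue \<and> integrable lebesgue (\<lambda>x. (norm (f x))\<^sup>2)}"

definition L2_norm :: "((real^'n) \<Rightarrow> (complex^'m)) \<Rightarrow> real" where
  "L2_norm f = sqrt (LINT x|lebesgue. (norm (f x))\<^sup>2)"

definition L1w :: "real \<Rightarrow> ((real^'n) \<Rightarrow> (complex^'m)) set" where
  "L1w \<kappa> = {f. integrable lebesgue f \<and>
               integrable lebesgue (\<lambda>x. (1 + norm x) powr \<kappa> * norm (f x))}"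

definition L1w_norm :: "real \<Rightarrow> ((real^'n) \<Rightarrow> (complex^'m)) \<Rightarrow> real" where
  "L1w_norm \<kappa> f = (LINT x|lebesgue. (1 + norm x) powr \<kappa> * norm (f x))"

definition total_mass :: "((real^'n) \<Rightarrow> (complex^'m)) \<Rightarrow> complex^'m" where
  "total_mass f = (LINT x|lebesgue. f x)"

text \<open>The Fourier transform with the unitary normalisation. It has the kernel
  \<open>exp (- i x \<bullet> \<xi>)\<close>, for which \<open>-\<Delta>\<close> has symbol \<open>|\<xi>|\<^sup>2\<close>.\<close>

definition fourier_L1 :: "((real^'n) \<Rightarrow> (complex^'m)) \<Rightarrow> (real^'n) \<Rightarrow> (complex^'m)" where
  "fourier_L1 f \<xi> = (2 * pi) powr (- real CARD('n) / 2) *\<^sub>R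
     (LINT x|lebesgue. exp (- \<i> * complex_of_real (x \<bullet> \<xi>)) *s f x)"

text \<open>The Fourier--Plancherel transform on \<open>L\<^sup>2\<close>: the limit in \<open>L\<^sup>2\<close> of the transforms of the
  truncations to balls. It is determined up to a null set, hence a relation. The distance is a
  nonnegative integral, as a Bochner integral would be \<open>0\<close> for a difference outside \<open>L\<^sup>2\<close>.\<close>

definition has_fourier ::
    "((real^'n) \<Rightarrow> (complex^'m)) \<Rightarrow> ((real^'n) \<Rightarrow> (complex^'m)) \<Rightarrow> bool" where
  "has_fourier f g \<longleftrightarrow> f \<in> L2 \<and> g \<in> L2 \<and>
     ((\<lambda>R. \<integral>\<^sup>+\<xi>. ennreal ((norm (fourier_L1 (\<lambda>x. indicator (cball 0 R) x *\<^sub>R f x) \<xi> - g \<xi>))\<^sup>2)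
             \<partial>lebesgue) \<longlongrightarrow> 0) at_top"

definition fourier :: "((real^'n) \<Rightarrow> (complex^'m)) \<Rightarrow> (real^'n) \<Rightarrow> (complex^'m)" where
  "fourier f = (SOME g. has_fourier f g)"

text \<open>The symbol \<open>|\<xi>|\<^sup>2\<^sup>\<nu>\<close> of \<open>(-\<Delta>)\<^sup>\<nu>\<close>; the case distinction is there because
  \<open>0 powr 0 = 0\<close>.\<close>

definition laplace_symbol :: "real \<Rightarrow> (real^'n) \<Rightarrow> real" where
  "laplace_symbol \<nu> \<xi> = (if \<nu> = 0 then 1 else norm \<xi> powr (2 * \<nu>))"

text \<open>The spaces \<open>H\<^sup>s\<close> and (restricted to \<open>L\<^sup>2\<close> functions) homogeneous \<open>H\<^sup>s\<close>, both for \<open>s \<ge> 0\<close>.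
  By Plancherel's theorem every \<open>L\<^sup>2\<close> function has a transform, and so membership only asks for
  the weighted transform to be square integrable.\<close>

definition Sobolev :: "real \<Rightarrow> ((real^'n) \<Rightarrow> (complex^'m)) set" where
  "Sobolev s = {f. \<exists>g. has_fourier f g \<and> (\<lambda>\<xi>. (1 + (norm \<xi>)\<^sup>2) powr (s/2) *\<^sub>R g \<xi>) \<in> L2}"

definition Sobolev_norm :: "real \<Rightarrow> ((real^'n) \<Rightarrow> (complex^'m)) \<Rightarrow> real" where
  "Sobolev_norm s f = L2_norm (\<lambda>\<xi>. (1 + (norm \<xi>)\<^sup>2) powr (s/2) *\<^sub>R fourier f \<xi>)"

definition hom_Sobolev :: "real \<Rightarrow> ((real^'n) \<Rightarrow> (complex^'m)) set" where
  "hom_Sobolev s = {f. \<exists>g. has_fourier f g \<and> (\<lambda>\<xi>. laplace_symbol (s/2) \<xi> *\<^sub>R g \<xi>) \<in> L2}"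

definition hom_Sobolev_norm :: "real \<Rightarrow> ((real^'n) \<Rightarrow> (complex^'m)) \<Rightarrow> real" where
  "hom_Sobolev_norm s f = L2_norm (\<lambda>\<xi>. laplace_symbol (s/2) \<xi> *\<^sub>R fourier f \<xi>)"

definition B0 :: "complex^3^3" where
  "B0 = vector [vector [\<i>, 0, 0], vector [0, - \<i>, 0], vector [0, 0, 0]]"

definition B1 :: "complex^3^3" where
  "B1 = vector [vector [0, 0, 1], vector [0, 0, 1], vector [- 1/2, - 1/2, - 1]]"

text \<open>Solutions of \<open>w\<^sub>t = B\<^sub>0 (-\<Delta>)\<^bsup>\<sigma>/2\<^esup> w + B\<^sub>1 (-\<Delta>)\<^bsup>\<sigma>\<alpha>\<^esup> w\<close>, \<open>w(0) = w\<^sub>0\<close>: the transforms \<open>W t\<close> of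
  \<open>w t\<close> can be chosen such that for almost every \<open>\<xi>\<close> the function \<open>t \<mapsto> W t \<xi>\<close> solves the
  transformed initial value problem.\<close>

definition is_solution ::
    "real \<Rightarrow> real \<Rightarrow> ((real^'n) \<Rightarrow> (complex^3)) \<Rightarrow> (real \<Rightarrow> (real^'n) \<Rightarrow> (complex^3)) \<Rightarrow> bool" where
  "is_solution \<sigma> \<alpha> w0 w \<longleftrightarrow> (\<exists>W.
     (\<forall>t\<ge>0. has_fourier (w t) (W t)) \<and>
     has_fourier w0 (W 0) \<and>
     (AE \<xi> in lebesgue. continuous_on {0..} (\<lambda>t. W t \<xi>) \<and>
        (\<forall>t>0. ((\<lambda>t. W t \<xi>) has_vector_derivative
           (laplace_symbol (\<sigma>/2) \<xi> *\<^sub>R B0 + laplace_symbol (\<sigma> * \<alpha>) \<xi> *\<^sub>R B1) *v W t \<xi>) (at t))))"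

end

theory Submission
  imports Defs "HOL-Real_Asymp.Real_Asymp"
begin

text \<open>
  Everything happens on the Fourier side, one frequency at a time. With \<open>a = |\<xi>|\<^sup>\<sigma>\<close> and
  \<open>b = |\<xi>|\<^bsup>2\<sigma>\<alpha>\<^esup>\<close>, the variables \<open>p = (w\<^sub>1 + w\<^sub>2)/2\<close>, \<open>q = (w\<^sub>1 - w\<^sub>2)/(2\<i>)\<close>, \<open>z = w\<^sub>3\<close> satisfy
  \<open>p' = - a q + b z\<close>, \<open>q' = a p\<close>, \<open>z' = - b p - b z\<close>. The energy \<open>|p|\<^sup>2 + |q|\<^sup>2 + |z|\<^sup>2\<close> loses only
  \<open>2 b |z|\<^sup>2\<close>, so the damping of \<open>z\<close> has to be carried over to \<open>p\<close> by the coupling \<open>b\<close> and from \<open>p\<close>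
  to \<open>q\<close> by the rotation \<open>a\<close>. Adding small multiples \<open>\<beta> \<langle>z, p\<rangle> + \<gamma> \<langle>p, q\<rangle>\<close> to the energy makes this
  visible: for suitable weights, depending on \<open>a / b\<close> only, the modified energy decays at a rate
  comparable to \<open>min (a\<^sup>2 / b) (b\<^sup>3 / a\<^sup>2)\<close> (lemmas \<open>energy_decay\<close> and \<open>symbol_flow_decay\<close>). The two
  candidates are \<open>|\<xi>|\<^bsup>2\<sigma> - 2\<sigma>\<alpha>\<^esup>\<close> and \<open>|\<xi>|\<^bsup>6\<sigma>\<alpha> - 2\<sigma>\<^esup>\<close>.

  For \<open>|\<xi>| \<le> 1\<close> the slower one has the larger exponent \<open>\<theta>\<close>, which is \<open>2\<sigma> - 2\<sigma>\<alpha>\<close> for \<open>\<alpha> \<le> 1/2\<close> and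
  \<open>6\<sigma>\<alpha> - 2\<sigma>\<close> for \<open>\<alpha> \<ge> 1/2\<close>; in both cases \<open>\<theta> \<ge> \<sigma> \<ge> 1\<close>. There the transform of the datum
  is at most a multiple of \<open>|\<xi>|\<^sup>\<kappa> \<parallel>w\<^sub>0\<parallel> + |P|\<close>, the norm being that of \<open>L\<^bsup>1,\<kappa>\<^esup>\<close> (lemma \<open>fourier_L1_bound\<close>), and the polynomial decay
  comes from the integral of \<open>|\<xi>|\<^bsup>2\<mu>\<^esup> exp (- c |\<xi>|\<^sup>\<theta> t)\<close> over the unit ball, with \<open>\<mu> = s\<^sub>0 + \<kappa>\<close> and
  \<open>\<mu> = s\<^sub>0\<close> (lemma \<open>low_frequency_integral\<close>).

  For \<open>|\<xi>| \<ge> 1\<close> both exponents are nonnegative if \<open>\<alpha> \<ge> 1/3\<close>, so the rate is bounded below and the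
  decay is exponential. If \<open>\<alpha> < 1/3\<close> the rate \<open>y = |\<xi>|\<^bsup>- 2\<sigma>(1 - 3\<alpha>)\<^esup>\<close> degenerates at infinity, and
  \<open>l\<close> derivatives of the datum buy a power of \<open>y\<close>, hence of \<open>1 / (1 + t)\<close>
  (lemma \<open>high_frequency_regularity_loss\<close>).

  The passage between functions and transforms only uses that the Fourier--Plancherel transform is
  unique almost everywhere and agrees with the Fourier integral on \<open>L\<^sup>1 \<inter> L\<^sup>2\<close>.
\<close>

section \<open>Hypocoercive decay at a fixed frequency\<close>

text \<open>The left-hand side is the time derivative of the modified energy along the system
  \<open>p' = - a q + b z\<close>, \<open>q' = a p\<close>, \<open>z' = - b p - b z\<close>. Of the two indefinite products,
  \<open>\<beta> b \<langle>z, p\<rangle>\<close> is absorbed because \<open>\<beta>\<close> is small, and \<open>(\<gamma> b - \<beta> a) \<langle>z, q\<rangle>\<close> because its coefficient is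
  at most the geometric mean of the dissipation \<open>b\<close> of \<open>z\<close> and the dissipation \<open>\<gamma> a\<close> of \<open>q\<close>; this is
  what the last assumption says. The condition \<open>4 \<gamma> a \<le> \<beta> b\<close> keeps the term \<open>\<gamma> a |p|\<^sup>2\<close>, which the
  rotation produces with the wrong sign, below the dissipation of \<open>p\<close>.\<close>

lemma lyapunov_dissipation:
  fixes p q z :: complex and a b \<beta> \<gamma> :: real
  assumes "0 < b" "0 \<le> \<beta>" "\<beta> \<le> 1/8" "0 \<le> \<gamma>" "0 < a"
    and "4 * (\<gamma> * a) \<le> \<beta> * b" and cross: "(\<gamma> * b - \<beta> * a)\<^sup>2 \<le> \<gamma> * a * b"
  shows "-2 * b * (z \<bullet> z) + \<beta> * (- b * (p \<bullet> p) - b * (z \<bullet> p) - a * (z \<bullet> q) + b * (z \<bullet> z))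
      + \<gamma> * (- a * (q \<bullet> q) + b * (z \<bullet> q) + a * (p \<bullet> p))
    \<le> - (\<gamma> * a / 2) * (p \<bullet> p + q \<bullet> q + z \<bullet> z)"
proof -
  define d where "d = \<gamma> * b - \<beta> * a"
  have bb: "\<beta> * b \<le> b / 8" using assms(1,3) by simp
  have "0 \<le> (z + p) \<bullet> (z + p)" by simp
  then have zp: "- (z \<bullet> p) \<le> (z \<bullet> z + p \<bullet> p) / 2"
    by (simp add: inner_add inner_commute)
  have "\<beta> * b * (- (z \<bullet> p)) \<le> \<beta> * b * ((z \<bullet> z + p \<bullet> p) / 2)"
    using assms by (intro mult_left_mono zp) auto
  then have 1: "- (\<beta> * b * (z \<bullet> p)) \<le> \<beta> * b / 2 * (z \<bullet> z) + \<beta> * b / 2 * (p \<bullet> p)"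
    by (simp add: field_simps)
  have "0 \<le> (b *\<^sub>R z - d *\<^sub>R q) \<bullet> (b *\<^sub>R z - d *\<^sub>R q)" by (rule inner_ge_zero)
  then have "2 * b * d * (z \<bullet> q) \<le> b\<^sup>2 * (z \<bullet> z) + d\<^sup>2 * (q \<bullet> q)"
    by (simp add: inner_diff inner_commute power2_eq_square algebra_simps)
  also have "d\<^sup>2 * (q \<bullet> q) \<le> (\<gamma> * a * b) * (q \<bullet> q)"
    using cross unfolding d_def by (rule mult_right_mono) simp
  finally have "b * (2 * d * (z \<bullet> q)) \<le> b * (b * (z \<bullet> z) + \<gamma> * a * (q \<bullet> q))"
    by (simp add: power2_eq_square algebra_simps)
  then have 2: "2 * d * (z \<bullet> q) \<le> b * (z \<bullet> z) + \<gamma> * a * (q \<bullet> q)"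
    using assms(1) by simp
  have 3: "\<gamma> * a * (p \<bullet> p) \<le> \<beta> * b / 4 * (p \<bullet> p)"
    using assms by (intro mult_right_mono) auto
  have 4: "\<beta> * b * (z \<bullet> z) \<le> b / 8 * (z \<bullet> z)"
    using bb by (intro mult_right_mono) auto
  have "\<gamma> * a \<le> b" using assms(6) bb assms(1) by linarith
  then have 5: "\<gamma> * a * (z \<bullet> z) \<le> b * (z \<bullet> z)"
    by (intro mult_right_mono) auto
  have 6: "0 \<le> \<beta> * b * (p \<bullet> p)" "0 \<le> b * (z \<bullet> z)" using assms by auto
  define S where "S = \<beta> * b / 2 * (z \<bullet> z) + \<beta> * b / 2 * (p \<bullet> p) + \<beta> * b * (z \<bullet> p)"
  have S: "0 \<le> S" using 1 unfolding S_def by linarith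
  \<comment> \<open>The gap between the two sides is a combination of the slacks of the preceding inequalities
    with nonnegative coefficients.\<close>
  have "- (\<gamma> * a / 2) * (p \<bullet> p + q \<bullet> q + z \<bullet> z) -
      (-2 * b * (z \<bullet> z) + \<beta> * (- b * (p \<bullet> p) - b * (z \<bullet> p) - a * (z \<bullet> q) + b * (z \<bullet> z))
        + \<gamma> * (- a * (q \<bullet> q) + b * (z \<bullet> q) + a * (p \<bullet> p)))
    = S
      + 1/2 * (b * (z \<bullet> z) + \<gamma> * a * (q \<bullet> q) - 2 * d * (z \<bullet> q))
      + 3/2 * (\<beta> * b / 4 * (p \<bullet> p) - \<gamma> * a * (p \<bullet> p))
      + 3/2 * (b / 8 * (z \<bullet> z) - \<beta> * b * (z \<bullet> z))
      + 1/2 * (b * (z \<bullet> z) - \<gamma> * a * (z \<bullet> z))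
      + 1/8 * (\<beta> * b * (p \<bullet> p)) + 13/16 * (b * (z \<bullet> z))"
    unfolding d_def S_def by (simp add: field_simps)
  moreover have "0 \<le> \<dots>"
    by (intro add_nonneg_nonneg S) (use 2 3 4 5 6 in simp_all)
  ultimately show ?thesis by (metis diff_ge_0_iff_ge)
qed

text \<open>Since \<open>\<beta>\<close> and \<open>\<gamma>\<close> are at most \<open>1/8\<close>, the modified energy \<open>L\<close> lies between \<open>E/2\<close> and \<open>2 E\<close>,
  so the dissipation inequality closes to \<open>L' \<le> - rate * L\<close>; the comparison of \<open>L\<close> with \<open>E\<close> at both
  ends of the time interval costs the factor 4.\<close>

lemma energy_decay:
  fixes p q z :: "real \<Rightarrow> complex" and a b \<beta> \<gamma> :: real
  assumes dp: "\<And>t. t > 0 \<Longrightarrow> (p has_vector_derivative (b *\<^sub>R z t - a *\<^sub>R q t)) (at t)"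
    and dq: "\<And>t. t > 0 \<Longrightarrow> (q has_vector_derivative (a *\<^sub>R p t)) (at t)"
    and dz: "\<And>t. t > 0 \<Longrightarrow> (z has_vector_derivative (- b *\<^sub>R p t - b *\<^sub>R z t)) (at t)"
    and cont: "continuous_on {0..} p" "continuous_on {0..} q" "continuous_on {0..} z"
    and "0 < a" "0 < b" "0 \<le> \<beta>" "\<beta> \<le> 1/8" "0 \<le> \<gamma>" "\<gamma> \<le> 1/8"
    and "4 * (\<gamma> * a) \<le> \<beta> * b" and "(\<gamma> * b - \<beta> * a)\<^sup>2 \<le> \<gamma> * a * b"
    and t: "0 \<le> t"
  defines "E \<equiv> \<lambda>t. p t \<bullet> p t + q t \<bullet> q t + z t \<bullet> z t"
  shows "E t \<le> 4 * exp (- (\<gamma> * a / 4) * t) * E 0"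
proof -
  define L where "L = (\<lambda>t. E t + \<beta> * (z t \<bullet> p t) + \<gamma> * (p t \<bullet> q t))"
  define rate where "rate = \<gamma> * a / 4"
  have cross: "\<bar>x \<bullet> y\<bar> \<le> (x \<bullet> x + y \<bullet> y) / 2" for x y :: complex
  proof -
    have "0 \<le> (x + y) \<bullet> (x + y)" "0 \<le> (x - y) \<bullet> (x - y)" by (rule inner_ge_zero)+
    then show ?thesis by (simp add: inner_add inner_diff inner_commute)
  qed
  have small: "\<bar>\<beta> * (z t \<bullet> p t) + \<gamma> * (p t \<bullet> q t)\<bar> \<le> E t / 2" for t
  proof -
    have "\<bar>\<beta> * (z t \<bullet> p t)\<bar> \<le> 1/8 * ((z t \<bullet> z t + p t \<bullet> p t) / 2)"
      unfolding abs_mult using assms cross by (intro mult_mono) auto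
    moreover have "\<bar>\<gamma> * (p t \<bullet> q t)\<bar> \<le> 1/8 * ((p t \<bullet> p t + q t \<bullet> q t) / 2)"
      unfolding abs_mult using assms cross by (intro mult_mono) auto
    moreover have "0 \<le> p t \<bullet> p t" "0 \<le> q t \<bullet> q t" "0 \<le> z t \<bullet> z t" by auto
    ultimately show ?thesis
      using abs_triangle_ineq[of "\<beta> * (z t \<bullet> p t)" "\<gamma> * (p t \<bullet> q t)"] unfolding E_def by argo
  qed
  have lower: "E t \<le> 2 * L t" and upper: "L t \<le> 2 * E t" and E0: "0 \<le> E t" for t
  proof -
    show "0 \<le> E t" by (simp add: E_def)
    then show "E t \<le> 2 * L t" "L t \<le> 2 * E t"
      using small[of t] unfolding L_def abs_le_iff by (auto simp: field_simps)
  qed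
  have dL: "\<exists>D. (L has_real_derivative D) (at t) \<and> D \<le> - rate * L t" if "t > 0" for t
  proof -
    have inner_deriv: "((\<lambda>t. f t \<bullet> g t) has_real_derivative (f t \<bullet> g' + f' \<bullet> g t)) (at t)"
      if "(f has_vector_derivative f') (at t)" "(g has_vector_derivative g') (at t)"
      for f g :: "real \<Rightarrow> complex" and f' g'
      using bounded_bilinear.has_vector_derivative[OF bounded_bilinear_inner that]
      by (simp add: has_real_derivative_iff_has_vector_derivative)
    note d = dp[OF that] dq[OF that] dz[OF that]
    define D where "D = -2 * b * (z t \<bullet> z t)
      + \<beta> * (- b * (p t \<bullet> p t) - b * (z t \<bullet> p t) - a * (z t \<bullet> q t) + b * (z t \<bullet> z t))
      + \<gamma> * (- a * (q t \<bullet> q t) + b * (z t \<bullet> q t) + a * (p t \<bullet> p t))"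
    have "(L has_real_derivative D) (at t)"
      unfolding L_def E_def D_def
      by (rule derivative_eq_intros inner_deriv d refl)+
        (simp add: inner_diff inner_add inner_commute algebra_simps)
    moreover have "D \<le> - (\<gamma> * a / 2) * (p t \<bullet> p t + q t \<bullet> q t + z t \<bullet> z t)"
      unfolding D_def by (rule lyapunov_dissipation) fact+
    moreover have "rate * L t \<le> rate * (2 * E t)"
      using upper[of t] assms by (intro mult_left_mono) (auto simp: rate_def)
    moreover have "rate * (2 * E t) = \<gamma> * a / 2 * E t" by (simp add: rate_def)
    moreover have "p t \<bullet> p t + q t \<bullet> q t + z t \<bullet> z t = E t" by (simp add: E_def)
    ultimately have "(L has_real_derivative D) (at t)" "D \<le> - rate * L t" by simp_all
    then show ?thesis by blast
  qed
  have "exp (rate * t) * L t \<le> exp (rate * 0) * L 0"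
  proof (rule DERIV_nonpos_imp_decreasing_open[where f = "\<lambda>x. exp (rate * x) * L x"])
    fix x assume x: "0 < x" "x < t"
    from dL[OF x(1)] obtain D where D: "(L has_real_derivative D) (at x)" "D \<le> - rate * L x"
      by blast
    have "((\<lambda>x. exp (rate * x) * L x) has_real_derivative exp (rate * x) * (rate * L x + D)) (at x)"
      by (rule derivative_eq_intros D(1) refl)+ (simp add: algebra_simps)
    moreover have "exp (rate * x) * (rate * L x + D) \<le> 0"
      using D(2) by (intro mult_nonneg_nonpos) auto
    ultimately show "\<exists>y. ((\<lambda>x. exp (rate * x) * L x) has_real_derivative y) (at x) \<and> y \<le> 0"
      by blast
  next
    show "0 \<le> t" by (rule t)
  next
    have *: "continuous_on {0..t} p" "continuous_on {0..t} q" "continuous_on {0..t} z"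
      using cont by (auto intro: continuous_on_subset)
    show "continuous_on {0..t} (\<lambda>x. exp (rate * x) * L x)"
      unfolding L_def E_def by (intro continuous_intros *)
  qed
  then have "exp (- rate * t) * (exp (rate * t) * L t) \<le> exp (- rate * t) * L 0"
    by (intro mult_left_mono) auto
  then have "L t \<le> exp (- rate * t) * L 0"
    by (simp add: mult.assoc[symmetric] exp_add[symmetric])
  moreover have "exp (- rate * t) * L 0 \<le> exp (- rate * t) * (2 * E 0)"
    using upper by (intro mult_left_mono) auto
  ultimately have "E t \<le> 4 * exp (- rate * t) * E 0" using lower[of t] by linarith
  then show ?thesis by (simp only: rate_def)
qed

lemma symbol_mult_vec:
  fixes w :: "complex^3"
  shows "((a *\<^sub>R B0 + b *\<^sub>R B1) *v w) $ 1 = \<i> * a * w $ 1 + b * w $ 3"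
    and "((a *\<^sub>R B0 + b *\<^sub>R B1) *v w) $ 2 = - \<i> * a * w $ 2 + b * w $ 3"
    and "((a *\<^sub>R B0 + b *\<^sub>R B1) *v w) $ 3 = - b / 2 * (w $ 1 + w $ 2) - b * w $ 3"
  by (simp_all add: B0_def B1_def matrix_vector_mult_def sum_3 scaleR_conv_of_real[where 'a = complex] algebra_simps
      add_divide_distrib)

text \<open>Weights that satisfy the constraints exist for all \<open>a\<close> and \<open>b\<close>, with \<open>\<gamma> a\<close> equal to
  \<open>a\<^sup>2 / (32 b)\<close> if \<open>a \<le> b\<close> and to \<open>b\<^sup>3 / (32 a\<^sup>2)\<close> if \<open>b \<le> a\<close>. Halving \<open>|w\<^sub>1|\<^sup>2 + |w\<^sub>2|\<^sup>2\<close> in the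
  energy turns the factor 4 into 8.\<close>

lemma symbol_flow_decay:
  fixes w :: "real \<Rightarrow> complex^3" and a b :: real
  assumes cont: "continuous_on {0..} w"
    and ode: "\<forall>t>0. (w has_vector_derivative (a *\<^sub>R B0 + b *\<^sub>R B1) *v w t) (at t)"
    and ab: "0 < a" "0 < b"
    and r: "r \<le> a\<^sup>2 / b" "r \<le> b^3 / a\<^sup>2" and t: "0 \<le> t"
  shows "(norm (w t))\<^sup>2 \<le> 8 * exp (- r / 128 * t) * (norm (w 0))\<^sup>2"
proof -
  define p where "p = (\<lambda>t. (w t $ 1 + w t $ 2) / 2)"
  define q where "q = (\<lambda>t. (w t $ 1 - w t $ 2) / (2 * \<i>))"
  define z where "z = (\<lambda>t. w t $ 3)"
  define E where "E = (\<lambda>t. p t \<bullet> p t + q t \<bullet> q t + z t \<bullet> z t)"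
  have nw: "(norm (w t))\<^sup>2 = (cmod (w t $ 1))\<^sup>2 + (cmod (w t $ 2))\<^sup>2 + (cmod (w t $ 3))\<^sup>2" for t
    by (simp add: norm_vec_def L2_set_def sum_3)
  have Eeq: "E t = ((cmod (w t $ 1))\<^sup>2 + (cmod (w t $ 2))\<^sup>2) / 2 + (cmod (w t $ 3))\<^sup>2" for t
    unfolding E_def p_def q_def z_def
    by (simp add: dot_square_norm norm_divide norm_mult power_divide cmod_power2)
      (simp add: field_simps power2_eq_square)
  have comp: "((\<lambda>t. w t $ i) has_vector_derivative ((a *\<^sub>R B0 + b *\<^sub>R B1) *v w t) $ i) (at t)"
    if "t > 0" for t i
    using bounded_linear.has_vector_derivative[OF bounded_linear_vec_nth ode[rule_format, OF that]] .
  have c: "continuous_on {0..} (\<lambda>t. w t $ i)" for i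
    using cont by (intro continuous_intros)
  obtain \<beta> \<gamma> where bg: "0 \<le> \<beta>" "\<beta> \<le> 1/8" "0 \<le> \<gamma>" "\<gamma> \<le> 1/8"
      "4 * (\<gamma> * a) \<le> \<beta> * b" "(\<gamma> * b - \<beta> * a)\<^sup>2 \<le> \<gamma> * a * b" "r / 32 \<le> \<gamma> * a"
  \<comment> \<open>Strong coupling permits a fixed \<open>\<beta>\<close>, and then \<open>\<gamma> b\<close> may only be of the order of \<open>a\<close>. For weak
    coupling \<open>\<gamma> a \<le> \<beta> b / 4\<close> and \<open>\<beta>\<^sup>2 a \<lesssim> \<gamma> b\<close> force \<open>\<beta>\<close> to be of the order of \<open>(b / a)\<^sup>2\<close> at most, and
    \<open>\<gamma>\<close> of the order of \<open>(b / a)\<^sup>3\<close>.\<close>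
  proof (cases "a \<le> b")
    case True
    define m where "m = a / b"
    have m: "0 < m" "m \<le> 1" "a = m * b" using ab True by (auto simp: m_def)
    show ?thesis
    proof (rule that[of "1/8" "m / 32"])
      show "4 * (m / 32 * a) \<le> 1 / 8 * b" using m ab mult_mono[of m 1 m 1]
        by (simp add: m(3) mult.assoc[symmetric] del: mult.assoc)
      show "(m / 32 * b - 1 / 8 * a)\<^sup>2 \<le> m / 32 * a * b"
        using m ab by (simp add: m(3) power2_eq_square algebra_simps)
      show "r / 32 \<le> m / 32 * a" using r(1) by (simp add: m_def power2_eq_square)
    qed (use m in auto)
  next
    case False
    define m where "m = b / a"
    have m: "0 < m" "m \<le> 1" "b = m * a" using ab False by (auto simp: m_def)
    have m2: "m\<^sup>2 \<le> 1" "m ^ 3 \<le> 1" using m by (auto intro!: power_le_one)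
    show ?thesis
    proof (rule that[of "m\<^sup>2 / 8" "m ^ 3 / 32"])
      show "4 * (m ^ 3 / 32 * a) \<le> m\<^sup>2 / 8 * b"
        by (simp add: m(3) power3_eq_cube power2_eq_square)
      have "(m ^ 3 / 32 * b - m\<^sup>2 / 8 * a)\<^sup>2 = (m\<^sup>2 * a)\<^sup>2 * (1/8 - m\<^sup>2 / 32)\<^sup>2"
        by (simp add: m(3) power3_eq_cube power2_eq_square algebra_simps)
      also have "\<dots> \<le> (m\<^sup>2 * a)\<^sup>2 * (1/8)\<^sup>2"
        using m2 by (intro mult_left_mono power_mono) auto
      also have "\<dots> \<le> m ^ 3 / 32 * a * b"
        using m ab by (simp add: m(3) power3_eq_cube power2_eq_square)
      finally show "(m ^ 3 / 32 * b - m\<^sup>2 / 8 * a)\<^sup>2 \<le> m ^ 3 / 32 * a * b" .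
      show "r / 32 \<le> m ^ 3 / 32 * a" using r(2) ab
        by (simp add: m_def power2_eq_square power3_eq_cube)
    qed (use m m2 in auto)
  qed
  have "E t \<le> 4 * exp (- (\<gamma> * a / 4) * t) * E 0"
    unfolding E_def
  proof (rule energy_decay[where p = p and q = q and z = z and \<beta> = \<beta> and b = b])
    show "(p has_vector_derivative b *\<^sub>R z t - a *\<^sub>R q t) (at t)" if "0 < t" for t
      unfolding p_def q_def z_def
      by (rule has_vector_derivative_eq_rhs, (rule derivative_intros comp that)+)
        (simp add: symbol_mult_vec scaleR_conv_of_real[where 'a = complex] field_simps)
    show "(q has_vector_derivative a *\<^sub>R p t) (at t)" if "0 < t" for t
      unfolding p_def q_def z_def
      by (rule has_vector_derivative_eq_rhs, (rule derivative_intros comp that)+)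
        (simp add: symbol_mult_vec scaleR_conv_of_real[where 'a = complex] field_simps)
    show "(z has_vector_derivative - b *\<^sub>R p t - b *\<^sub>R z t) (at t)" if "0 < t" for t
      unfolding p_def q_def z_def
      by (rule has_vector_derivative_eq_rhs, (rule derivative_intros comp that)+)
        (simp add: symbol_mult_vec scaleR_conv_of_real[where 'a = complex] field_simps)
  qed (use bg ab t in \<open>auto simp: p_def q_def z_def intro!: continuous_intros c\<close>)
  also have "\<dots> \<le> 4 * exp (- r / 128 * t) * E 0"
  proof -
    have "- (\<gamma> * a / 4) * t \<le> - r / 128 * t"
      using bg(7) t by (intro mult_right_mono) auto
    then show ?thesis
      by (intro mult_right_mono mult_left_mono) (auto simp: E_def)
  qed
  also have "\<dots> \<le> 4 * exp (- r / 128 * t) * (norm (w 0))\<^sup>2"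
    unfolding Eeq nw by (intro mult_left_mono) auto
  finally have "E t \<le> 4 * exp (- r / 128 * t) * (norm (w 0))\<^sup>2" .
  moreover have "(norm (w t))\<^sup>2 \<le> 2 * E t" by (simp add: nw Eeq field_simps)
  ultimately show ?thesis by simp
qed

section \<open>Decay in time of weights in frequency\<close>

lemma summable_poly_exp:
  fixes m c :: real assumes "c > 0"
  shows "summable (\<lambda>k. (real k + 1) powr m * exp (- c * real k))"
proof (rule summable_comparison_test_bigo)
  show "summable (\<lambda>k. norm (1 / real k ^ 2))"
    using inverse_power_summable[of 2, where 'a = real] by (simp add: inverse_eq_divide)
  show "(\<lambda>k. (real k + 1) powr m * exp (- c * real k)) \<in> O(\<lambda>k. 1 / real k ^ 2)"
    using assms by real_asymp
qed

lemma powr_floor_lower_bound: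
  fixes y \<theta> :: real assumes "0 \<le> y" "1 \<le> \<theta>"
  shows "real (nat \<lfloor>y\<rfloor>) \<le> y powr \<theta>"
proof (cases "y < 1")
  case False
  then have "real (nat \<lfloor>y\<rfloor>) \<le> y powr 1" by simp
  also have "\<dots> \<le> y powr \<theta>" using False assms by (intro powr_mono) auto
  finally show ?thesis .
next
  case True
  then have "\<lfloor>y\<rfloor> = 0" using assms by (simp add: floor_eq_iff)
  then show ?thesis by simp
qed

text \<open>Rescaling by \<open>\<epsilon> = (1 + t)\<^bsup>-1/\<theta>\<^esup>\<close> turns the exponent into \<open>(|\<xi>| / \<epsilon>)\<^sup>\<theta>\<close>, up to a bounded
  factor, since \<open>|\<xi>|\<^sup>\<theta> \<le> 1\<close> allows \<open>t\<close> to be replaced by \<open>1 + t\<close>. On the shell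
  \<open>k \<epsilon> \<le> |\<xi>| < (k + 1) \<epsilon>\<close> the integrand is at most the number \<open>a k\<close> defined in the proof, so the balls of radius \<open>(k + 1) \<epsilon>\<close>
  bound the integral by \<open>\<epsilon>\<^bsup>n + 2\<mu>\<^esup>\<close> times a convergent series in \<open>k\<close> that does not depend on \<open>t\<close>.\<close>

lemma low_frequency_integral:
  fixes \<mu> \<theta> c :: real
  assumes mu: "0 \<le> \<mu>" and theta: "1 \<le> \<theta>" and c: "0 < c"
  obtains C where "C > 0"
    and "\<And>t. t \<ge> 0 \<Longrightarrow> integrable lebesgue (\<lambda>\<xi>::real^'n. indicator (cball 0 1) \<xi> *
            (norm \<xi> powr (2 * \<mu>) * exp (- c * norm \<xi> powr \<theta> * t)))"
    and "\<And>t. t \<ge> 0 \<Longrightarrow> (LINT \<xi>|lebesgue. indicator (cball 0 1) (\<xi>::real^'n) *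
            (norm \<xi> powr (2 * \<mu>) * exp (- c * norm \<xi> powr \<theta> * t)))
          \<le> C * (1 + t) powr (- (real CARD('n) + 2 * \<mu>) / \<theta>)"
proof -
  define n where "n = real CARD('n)"
  define f where "f = (\<lambda>t (\<xi>::real^'n). indicator (cball 0 1) \<xi> *
            (norm \<xi> powr (2 * \<mu>) * exp (- c * norm \<xi> powr \<theta> * t)))"
  define v where "v = unit_ball_vol n"
  define S where "S = (\<Sum>k. (real k + 1) powr (n + 2 * \<mu>) * exp (- c * real k))"
  have sum: "summable (\<lambda>k. (real k + 1) powr (n + 2 * \<mu>) * exp (- c * real k))"
    by (rule summable_poly_exp) fact
  have S: "0 \<le> S" unfolding S_def by (rule suminf_nonneg[OF sum]) auto
  have v: "0 \<le> v" by (simp add: v_def n_def)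
  have f_nonneg: "0 \<le> f t \<xi>" for t \<xi> by (simp add: f_def)
  have f_meas: "f t \<in> borel_measurable lborel" for t
    unfolding f_def by (intro borel_measurable_times borel_measurable_indicator) auto
  have nn: "(\<integral>\<^sup>+\<xi>. ennreal (f t \<xi>) \<partial>lborel)
      \<le> ennreal (exp c * v * S * (1 + t) powr (- (n + 2 * \<mu>) / \<theta>))" if t: "0 \<le> t" for t
  proof -
    define \<epsilon> where "\<epsilon> = (1 + t) powr (- 1 / \<theta>)"
    have eps: "0 < \<epsilon>" using t by (simp add: \<epsilon>_def)
    have eps_theta: "\<epsilon> powr \<theta> = 1 / (1 + t)"
      using theta t unfolding \<epsilon>_def powr_powr by (simp add: powr_minus_divide)
    define a where "a = (\<lambda>k::nat. exp c * (\<epsilon> * (real k + 1)) powr (2 * \<mu>) * exp (- c * real k))"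
    have a: "0 \<le> a k" for k by (simp add: a_def)
    have ball: "emeasure lborel (cball (0::real^'n) (\<epsilon> * (real k + 1)))
        = ennreal (v * (\<epsilon> * (real k + 1)) powr n)" for k
      using eps by (subst emeasure_cball) (auto simp: v_def n_def powr_realpow)
    have "ennreal (f t \<xi>) \<le> (\<Sum>k. ennreal (a k) * indicator (cball 0 (\<epsilon> * (real k + 1))) \<xi>)" for \<xi>
    proof (cases "norm \<xi> \<le> 1")
      case True
      define y where "y = norm \<xi> / \<epsilon>"
      define k where "k = nat \<lfloor>y\<rfloor>"
      have y: "0 \<le> y" using eps by (simp add: y_def)
      have yk: "y \<le> real k + 1" unfolding k_def using y by linarith
      then have xi_le: "norm \<xi> \<le> \<epsilon> * (real k + 1)"
        using eps by (simp add: y_def field_simps)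
      have "real k \<le> y powr \<theta>" unfolding k_def using y theta by (rule powr_floor_lower_bound)
      also have "y powr \<theta> = norm \<xi> powr \<theta> * (1 + t)"
        using eps t by (simp add: y_def powr_divide eps_theta)
      also have "\<dots> \<le> norm \<xi> powr \<theta> * t + 1"
        using True theta powr_mono2[of \<theta> "norm \<xi>" 1] by (simp add: algebra_simps)
      finally have "c * real k \<le> c * (norm \<xi> powr \<theta> * t + 1)"
        using c by (intro mult_left_mono) auto
      then have "exp (- c * norm \<xi> powr \<theta> * t) \<le> exp c * exp (- c * real k)"
        by (simp add: exp_add[symmetric] algebra_simps)
      moreover have "norm \<xi> powr (2 * \<mu>) \<le> (\<epsilon> * (real k + 1)) powr (2 * \<mu>)"
        using xi_le mu by (intro powr_mono2) auto
      ultimately have "norm \<xi> powr (2 * \<mu>) * exp (- c * norm \<xi> powr \<theta> * t)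
          \<le> (\<epsilon> * (real k + 1)) powr (2 * \<mu>) * (exp c * exp (- c * real k))"
        by (intro mult_mono) auto
      then have "f t \<xi> \<le> a k" using True by (simp add: f_def a_def mult_ac)
      then have "ennreal (f t \<xi>) \<le> ennreal (a k) * indicator (cball 0 (\<epsilon> * (real k + 1))) \<xi>"
        using xi_le by (simp add: ennreal_leI)
      also have "\<dots> \<le> (\<Sum>k. ennreal (a k) * indicator (cball 0 (\<epsilon> * (real k + 1))) \<xi>)"
        by (rule order_trans[OF eq_refl sum_le_suminf[OF summableI, of "{k}"]])
          (simp_all del: sum_mult_indicator)
      finally show ?thesis .
    qed (simp add: f_def)
    then have "(\<integral>\<^sup>+\<xi>. ennreal (f t \<xi>) \<partial>lborel)
        \<le> (\<integral>\<^sup>+\<xi>. (\<Sum>k. ennreal (a k) * indicator (cball 0 (\<epsilon> * (real k + 1))) \<xi>)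
              \<partial>(lborel :: (real^'n) measure))"
      by (intro nn_integral_mono)
    also have "\<dots> = (\<Sum>k. \<integral>\<^sup>+\<xi>. ennreal (a k) * indicator (cball 0 (\<epsilon> * (real k + 1))) \<xi>
              \<partial>(lborel :: (real^'n) measure))"
      by (rule nn_integral_suminf) (intro borel_measurable_times_ennreal borel_measurable_indicator; simp)
    also have "\<dots> = (\<Sum>k. ennreal (a k * (v * (\<epsilon> * (real k + 1)) powr n)))"
      using a v by (simp add: nn_integral_cmult_indicator ball ennreal_mult)
    also have "\<dots> = (\<Sum>k. ennreal (exp c * v * \<epsilon> powr (n + 2 * \<mu>)
          * ((real k + 1) powr (n + 2 * \<mu>) * exp (- c * real k))))"
      using eps by (simp add: a_def powr_mult powr_add mult_ac)
    also have "\<dots> = ennreal (\<Sum>k. exp c * v * \<epsilon> powr (n + 2 * \<mu>)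
          * ((real k + 1) powr (n + 2 * \<mu>) * exp (- c * real k)))"
      by (rule suminf_ennreal2[OF _ summable_mult[OF sum]]) (use v in simp)
    also have "\<dots> = ennreal (exp c * v * \<epsilon> powr (n + 2 * \<mu>) * S)"
      by (simp only: S_def suminf_mult[OF sum])
    also have "\<epsilon> powr (n + 2 * \<mu>) = (1 + t) powr (- (n + 2 * \<mu>) / \<theta>)"
    proof -
      have "- 1 / \<theta> * (n + 2 * \<mu>) = - (n + 2 * \<mu>) / \<theta>"
        using theta by (simp add: field_simps)
      then show ?thesis by (simp only: \<epsilon>_def powr_powr)
    qed
    finally show ?thesis by (simp add: mult_ac)
  qed
  define C where "C = exp c * v * S + 1"
  have C: "C > 0" using v S by (simp add: C_def add_nonneg_pos)
  have int: "integrable lebesgue (f t)" if "0 \<le> t" for t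
  proof -
    have "integrable lborel (f t)"
      using f_nonneg nn[OF that] f_meas
      by (intro integrableI_nonneg) (auto intro: le_less_trans)
    then show ?thesis using f_meas by (simp add: integrable_completion)
  qed
  have bound: "integral\<^sup>L lebesgue (f t) \<le> C * (1 + t) powr (- (n + 2 * \<mu>) / \<theta>)" if "0 \<le> t" for t
  proof -
    have "ennreal (integral\<^sup>L lebesgue (f t)) = (\<integral>\<^sup>+\<xi>. ennreal (f t \<xi>) \<partial>lebesgue)"
      using int[OF that] f_nonneg by (simp add: nn_integral_eq_integral)
    also have "\<dots> \<le> ennreal (exp c * v * S * (1 + t) powr (- (n + 2 * \<mu>) / \<theta>))"
      using nn[OF that] by (simp add: nn_integral_completion)
    finally have "integral\<^sup>L lebesgue (f t) \<le> exp c * v * S * (1 + t) powr (- (n + 2 * \<mu>) / \<theta>)"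
      using v S by (subst (asm) ennreal_le_iff) auto
    also have "\<dots> \<le> C * (1 + t) powr (- (n + 2 * \<mu>) / \<theta>)"
      by (intro mult_right_mono) (auto simp: C_def)
    finally show ?thesis .
  qed
  show ?thesis
    by (rule that[OF C]) (use int bound in \<open>auto simp: f_def n_def\<close>)
qed

text \<open>By \<open>ln z \<le> z - 1\<close> with \<open>z = c x / (p + 1)\<close>; the shift by \<open>1\<close> keeps \<open>z\<close> positive for \<open>p = 0\<close>.\<close>

lemma powr_times_exp_bounded:
  fixes p c x :: real
  assumes "0 \<le> p" "0 < c" "0 < x"
  shows "x powr p * exp (- c * x) \<le> ((p + 1) / c) powr p"
proof -
  define z where "z = c * x / (p + 1)"
  have z: "0 < z" using assms by (simp add: z_def)
  have "p * ln x = p * ln z + p * ln ((p + 1) / c)"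
    using assms by (simp add: z_def ln_div ln_mult algebra_simps)
  also have "p * ln z \<le> p * z"
    using ln_le_minus_one[OF z] assms(1) by (intro mult_left_mono) auto
  also have "p * z \<le> c * x"
    using assms by (simp add: z_def field_simps)
  finally have "exp (p * ln x - c * x) \<le> exp (p * ln ((p + 1) / c))" by simp
  then show ?thesis using assms by (simp add: powr_def exp_diff exp_minus field_simps)
qed

text \<open>The bound \<open>y \<le> 1\<close> makes it harmless to replace \<open>t\<close> by \<open>1 + t\<close>, after which
  \<open>x = y (1 + t)\<close> is the only variable.\<close>

lemma powr_exp_time_decay:
  fixes p c :: real
  assumes p: "0 \<le> p" and c: "0 < c"
  shows "\<exists>K>0. \<forall>y t. 0 < y \<longrightarrow> y \<le> 1 \<longrightarrow> 0 \<le> t \<longrightarrow> y powr p * exp (- c * y * t) \<le> K * (1 + t) powr (- p)"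
proof (intro exI[of _ "exp c * ((p + 1) / c) powr p"] conjI allI impI)
  show "0 < exp c * ((p + 1) / c) powr p" using assms by simp
  fix y t :: real assume y: "0 < y" "y \<le> 1" and t: "0 \<le> t"
  have e: "exp (c * y) * exp (- c * (y * (1 + t))) = exp (- c * y * t)"
    by (simp add: exp_add[symmetric] algebra_simps)
  have p: "(1 + t) powr (- p) * (y * (1 + t)) powr p = y powr p"
    using y t by (simp add: powr_mult powr_minus)
  have "y powr p * exp (- c * y * t)
      = (1 + t) powr (- p) * (exp (c * y) * ((y * (1 + t)) powr p * exp (- c * (y * (1 + t)))))"
    unfolding e[symmetric] p[symmetric] by (simp only: mult_ac)
  also have "\<dots> \<le> (1 + t) powr (- p) * (exp c * ((p + 1) / c) powr p)"
    using y t assms by (intro mult_left_mono mult_mono powr_times_exp_bounded) auto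
  finally show "y powr p * exp (- c * y * t) \<le> exp c * ((p + 1) / c) powr p * (1 + t) powr (- p)"
    by (simp add: mult_ac)
qed

section \<open>Fourier integrals and the Fourier--Plancherel transform\<close>

lemma norm_vector_smult: "norm (c *s v) = cmod c * norm (v :: complex^'m)"
  by (simp add: norm_vec_def L2_set_def norm_mult power_mult_distrib sum_distrib_left[symmetric]
      real_sqrt_mult)

lemma continuous_on_vector_smult [continuous_intros]:
  fixes g :: "'a::topological_space \<Rightarrow> complex^'m"
  assumes "continuous_on S c" "continuous_on S g"
  shows "continuous_on S (\<lambda>x. c x *s g x)"
  unfolding vector_scalar_mult_def by (intro continuous_intros assms)

lemma borel_measurable_vector_smult [measurable (raw)]:
  fixes g :: "'a \<Rightarrow> complex^'m"
  assumes "c \<in> borel_measurable M" "g \<in> borel_measurable M"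
  shows "(\<lambda>x. c x *s g x) \<in> borel_measurable M"
  by (rule borel_measurable_continuous_Pair[OF assms]) (intro continuous_intros)

lemma integrable_vector_smult_bounded:
  fixes f :: "'a \<Rightarrow> complex^'m"
  assumes "integrable M f" "c \<in> borel_measurable M" "\<And>x. cmod (c x) \<le> 1"
  shows "integrable M (\<lambda>x. c x *s f x)"
  using assms
  by (intro Bochner_Integration.integrable_bound[OF assms(1)] borel_measurable_vector_smult)
    (auto simp: norm_vector_smult intro!: mult_left_le_one_le)

abbreviation plane_wave :: "real^'n \<Rightarrow> real^'n \<Rightarrow> complex" where
  "plane_wave \<xi> x \<equiv> exp (- \<i> * complex_of_real (x \<bullet> \<xi>))"

lemma norm_plane_wave: "cmod (plane_wave \<xi> x) = 1"
  using norm_exp_i_times[of "- (x \<bullet> \<xi>)"] by simp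

lemma borel_measurable_plane_wave: "plane_wave \<xi> \<in> borel_measurable lebesgue"
  by (intro measurable_completion borel_measurable_continuous_onI) (auto intro!: continuous_intros)

lemma integrable_plane_wave_smult:
  fixes f :: "real^'n \<Rightarrow> complex^'m"
  assumes "integrable lebesgue f"
  shows "integrable lebesgue (\<lambda>x. plane_wave \<xi> x *s f x)"
  by (rule integrable_vector_smult_bounded[OF assms borel_measurable_plane_wave])
    (simp only: norm_plane_wave)

text \<open>Continuity supplies the measurability of Fourier integrals, on which the \<open>L\<^sup>2\<close> arguments
  with nonnegative integrals rest.\<close>

lemma continuous_on_fourier_L1:
  fixes f :: "real^'n \<Rightarrow> complex^'m"
  assumes f: "integrable lebesgue f"
  shows "continuous_on UNIV (fourier_L1 f)"
  unfolding continuous_on_sequentially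
proof (intro allI ballI impI, elim conjE)
  fix u :: "nat \<Rightarrow> real^'n" and \<xi> assume u: "u \<longlonglongrightarrow> \<xi>"
  have "(\<lambda>k. LINT x|lebesgue. plane_wave (u k) x *s f x)
      \<longlonglongrightarrow> (LINT x|lebesgue. plane_wave \<xi> x *s f x)"
  proof (rule integral_dominated_convergence[where w = "\<lambda>x. norm (f x)"])
    show "AE x in lebesgue. (\<lambda>k. plane_wave (u k) x *s f x) \<longlonglongrightarrow> plane_wave \<xi> x *s f x"
    proof (intro AE_I2)
      fix x :: "real^'n"
      have "continuous_on UNIV (\<lambda>\<xi>. plane_wave \<xi> x *s f x)"
        by (intro continuous_intros)
      then show "(\<lambda>k. plane_wave (u k) x *s f x) \<longlonglongrightarrow> plane_wave \<xi> x *s f x"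
        using u by (auto simp: continuous_on_sequentially o_def)
    qed
    show "AE x in lebesgue. norm (plane_wave (u k) x *s f x) \<le> norm (f x)" for k
      unfolding norm_vector_smult norm_plane_wave by simp
  qed (use f integrable_plane_wave_smult[OF f] in \<open>auto intro: borel_measurable_integrable\<close>)
  then show "(fourier_L1 f \<circ> u) \<longlonglongrightarrow> fourier_L1 f \<xi>"
    unfolding fourier_L1_def o_def by (intro tendsto_intros)
qed

lemma borel_measurable_fourier_L1:
  fixes f :: "real^'n \<Rightarrow> complex^'m"
  assumes "integrable lebesgue f"
  shows "fourier_L1 f \<in> borel_measurable lebesgue"
  by (rule measurable_completion)
    (simp add: borel_measurable_continuous_onI continuous_on_fourier_L1 assms)

text \<open>A ball has finite measure and \<open>y \<le> 1 + y\<^sup>2\<close>.\<close>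

lemma integrable_truncation_L2:
  fixes f :: "real^'n \<Rightarrow> complex^'m"
  assumes "f \<in> L2"
  shows "integrable lebesgue (\<lambda>x. indicator (cball 0 R) x *\<^sub>R f x)"
proof (rule Bochner_Integration.integrable_bound)
  have "integrable lebesgue (indicator (cball (0::real^'n) R) :: _ \<Rightarrow> real)"
    by (intro integrable_real_indicator) (use emeasure_bounded_finite[of "cball (0::real^'n) R"] in auto)
  then show "integrable lebesgue (\<lambda>x. indicator (cball (0::real^'n) R) x + (norm (f x))\<^sup>2)"
    using assms by (intro Bochner_Integration.integrable_add) (auto simp: L2_def)
  show "(\<lambda>x. indicator (cball 0 R) x *\<^sub>R f x) \<in> borel_measurable lebesgue"
    using assms by (intro borel_measurable_scaleR borel_measurable_indicator) (auto simp: L2_def)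
  have *: "y \<le> 1 + y\<^sup>2" for y :: real
    using zero_le_power2[of "y - 1/2"] by (simp add: power2_eq_square algebra_simps)
  show "AE x in lebesgue. norm (indicator (cball 0 R) x *\<^sub>R f x)
      \<le> norm (indicator (cball 0 R) x + (norm (f x))\<^sup>2)"
    using * by (intro AE_I2) (auto simp: indicator_def)
qed

text \<open>Both candidates are \<open>L\<^sup>2\<close> limits of the same truncated transforms, so their distance is \<open>0\<close>.\<close>

lemma has_fourier_unique:
  fixes f :: "real^'n \<Rightarrow> complex^'m"
  assumes g: "has_fourier f g" and h: "has_fourier f h"
  shows "AE \<xi> in lebesgue. g \<xi> = h \<xi>"
proof -
  define F where "F = (\<lambda>R. fourier_L1 (\<lambda>x. indicator (cball 0 R) x *\<^sub>R f x))"
  have [measurable]: "g \<in> borel_measurable lebesgue" "h \<in> borel_measurable lebesgue"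
      "F R \<in> borel_measurable lebesgue" for R
    using g h by (auto simp: has_fourier_def L2_def F_def
        intro!: borel_measurable_fourier_L1 integrable_truncation_L2)
  have lim: "((\<lambda>R. \<integral>\<^sup>+\<xi>. ennreal ((norm (F R \<xi> - k \<xi>))\<^sup>2) \<partial>lebesgue) \<longlongrightarrow> 0) at_top"
    if "has_fourier f k" for k using that by (simp add: has_fourier_def F_def)
  have "(\<integral>\<^sup>+\<xi>. ennreal ((norm (g \<xi> - h \<xi>))\<^sup>2) \<partial>lebesgue)
      \<le> 2 * (\<integral>\<^sup>+\<xi>. ennreal ((norm (F R \<xi> - g \<xi>))\<^sup>2) \<partial>lebesgue)
        + 2 * (\<integral>\<^sup>+\<xi>. ennreal ((norm (F R \<xi> - h \<xi>))\<^sup>2) \<partial>lebesgue)" for R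
  proof -
    have "(norm (g \<xi> - h \<xi>))\<^sup>2 \<le> 2 * (norm (F R \<xi> - g \<xi>))\<^sup>2 + 2 * (norm (F R \<xi> - h \<xi>))\<^sup>2" for \<xi>
    proof -
      have "norm (g \<xi> - h \<xi>) \<le> norm (F R \<xi> - g \<xi>) + norm (F R \<xi> - h \<xi>)"
        using norm_triangle_ineq4[of "F R \<xi> - h \<xi>" "F R \<xi> - g \<xi>"] by simp
      then have "(norm (g \<xi> - h \<xi>))\<^sup>2 \<le> (norm (F R \<xi> - g \<xi>) + norm (F R \<xi> - h \<xi>))\<^sup>2"
        by (intro power_mono) auto
      also have "\<dots> \<le> 2 * (norm (F R \<xi> - g \<xi>))\<^sup>2 + 2 * (norm (F R \<xi> - h \<xi>))\<^sup>2"
        using zero_le_power2[of "norm (F R \<xi> - g \<xi>) - norm (F R \<xi> - h \<xi>)"]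
        by (simp add: power2_eq_square algebra_simps)
      finally show ?thesis .
    qed
    then have "(\<integral>\<^sup>+\<xi>. ennreal ((norm (g \<xi> - h \<xi>))\<^sup>2) \<partial>lebesgue)
      \<le> (\<integral>\<^sup>+\<xi>. 2 * ennreal ((norm (F R \<xi> - g \<xi>))\<^sup>2) + 2 * ennreal ((norm (F R \<xi> - h \<xi>))\<^sup>2) \<partial>lebesgue)"
      by (intro nn_integral_mono)
        (simp add: ennreal_plus[symmetric] ennreal_mult'[symmetric] ennreal_leI
          del: ennreal_plus flip: ennreal_numeral)
    also have "\<dots> = 2 * (\<integral>\<^sup>+\<xi>. ennreal ((norm (F R \<xi> - g \<xi>))\<^sup>2) \<partial>lebesgue)
        + 2 * (\<integral>\<^sup>+\<xi>. ennreal ((norm (F R \<xi> - h \<xi>))\<^sup>2) \<partial>lebesgue)"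
      by (simp add: nn_integral_add nn_integral_cmult)
    finally show ?thesis .
  qed
  moreover have "((\<lambda>R. 2 * (\<integral>\<^sup>+\<xi>. ennreal ((norm (F R \<xi> - g \<xi>))\<^sup>2) \<partial>lebesgue)
        + 2 * (\<integral>\<^sup>+\<xi>. ennreal ((norm (F R \<xi> - h \<xi>))\<^sup>2) \<partial>lebesgue)) \<longlongrightarrow> 2 * 0 + 2 * 0) at_top"
    by (intro tendsto_add ennreal_tendsto_cmult lim g h) auto
  ultimately have "(\<integral>\<^sup>+\<xi>. ennreal ((norm (g \<xi> - h \<xi>))\<^sup>2) \<partial>lebesgue) \<le> 2 * 0 + 2 * 0"
    by (intro tendsto_lowerbound[where F = at_top]) auto
  then have "(\<integral>\<^sup>+\<xi>. ennreal ((norm (g \<xi> - h \<xi>))\<^sup>2) \<partial>lebesgue) = 0" by simp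
  then have "AE \<xi> in lebesgue. ennreal ((norm (g \<xi> - h \<xi>))\<^sup>2) = 0"
    by (subst (asm) nn_integral_0_iff_AE) auto
  then show ?thesis by eventually_elim simp
qed

lemma fourier_AE_eq:
  assumes "has_fourier f g"
  shows "AE \<xi> in lebesgue. fourier f \<xi> = g \<xi>"
  using has_fourier_unique[OF _ assms] someI[of "has_fourier f", OF assms]
  unfolding fourier_def by blast

lemma fourier_L1_truncation_tendsto:
  fixes f :: "real^'n \<Rightarrow> complex^'m"
  assumes f: "integrable lebesgue f"
  shows "(\<lambda>k. fourier_L1 (\<lambda>x. indicator (cball 0 (real k)) x *\<^sub>R f x) \<xi>) \<longlonglongrightarrow> fourier_L1 f \<xi>"
proof -
  have int: "integrable lebesgue (\<lambda>x. indicator (cball 0 R) x *\<^sub>R f x)" for R :: real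
    using f by (intro integrable_mult_indicator) auto
  have "(\<lambda>k. LINT x|lebesgue. plane_wave \<xi> x *s (indicator (cball 0 (real k)) x *\<^sub>R f x))
      \<longlonglongrightarrow> (LINT x|lebesgue. plane_wave \<xi> x *s f x)"
  proof (rule integral_dominated_convergence[where w = "\<lambda>x. norm (f x)"])
    show "AE x in lebesgue. (\<lambda>k. plane_wave \<xi> x *s (indicator (cball 0 (real k)) x *\<^sub>R f x))
        \<longlonglongrightarrow> plane_wave \<xi> x *s f x"
    proof (intro AE_I2 tendsto_eventually)
      fix x :: "real^'n"
      show "\<forall>\<^sub>F k in sequentially. plane_wave \<xi> x *s (indicator (cball 0 (real k)) x *\<^sub>R f x)
          = plane_wave \<xi> x *s f x"
        using eventually_ge_at_top[of "nat \<lceil>norm x\<rceil>"]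
        by eventually_elim (auto simp: indicator_def nat_le_iff ceiling_le_iff)
    qed
    show "AE x in lebesgue. norm (plane_wave \<xi> x *s (indicator (cball 0 (real k)) x *\<^sub>R f x))
        \<le> norm (f x)" for k
      unfolding norm_vector_smult norm_plane_wave by (auto simp: indicator_def)
  qed (use f integrable_plane_wave_smult[OF f] integrable_plane_wave_smult[OF int]
      in \<open>auto intro: borel_measurable_integrable\<close>)
  then show ?thesis
    unfolding fourier_L1_def by (intro tendsto_intros)
qed

text \<open>The truncated transforms converge to \<open>g\<close> in \<open>L\<^sup>2\<close> and to the Fourier integral pointwise;
  Fatou's lemma identifies the limits.\<close>

lemma has_fourier_eq_fourier_L1:
  fixes f :: "real^'n \<Rightarrow> complex^'m"
  assumes g: "has_fourier f g" and f: "integrable lebesgue f"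
  shows "AE \<xi> in lebesgue. g \<xi> = fourier_L1 f \<xi>"
proof -
  define F where "F = (\<lambda>k. fourier_L1 (\<lambda>x. indicator (cball 0 (real k)) x *\<^sub>R f x))"
  have [measurable]: "g \<in> borel_measurable lebesgue" "fourier_L1 f \<in> borel_measurable lebesgue"
      "F k \<in> borel_measurable lebesgue" for k
    using g f by (auto simp: has_fourier_def L2_def F_def
        intro!: borel_measurable_fourier_L1 integrable_truncation_L2)
  have lim: "(\<lambda>k. \<integral>\<^sup>+\<xi>. ennreal ((norm (F k \<xi> - g \<xi>))\<^sup>2) \<partial>lebesgue) \<longlonglongrightarrow> 0"
    using g filterlim_real_sequentially unfolding has_fourier_def F_def
    by (auto intro: filterlim_compose)
  have pt: "(\<lambda>k. ennreal ((norm (F k \<xi> - g \<xi>))\<^sup>2)) \<longlonglongrightarrow> ennreal ((norm (fourier_L1 f \<xi> - g \<xi>))\<^sup>2)"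
    for \<xi>
    using fourier_L1_truncation_tendsto[OF f] unfolding F_def
    by (intro tendsto_intros)
  have "(\<integral>\<^sup>+\<xi>. ennreal ((norm (fourier_L1 f \<xi> - g \<xi>))\<^sup>2) \<partial>lebesgue)
      = (\<integral>\<^sup>+\<xi>. liminf (\<lambda>k. ennreal ((norm (F k \<xi> - g \<xi>))\<^sup>2)) \<partial>lebesgue)"
    by (simp add: lim_imp_Liminf[OF _ pt])
  also have "\<dots> \<le> liminf (\<lambda>k. \<integral>\<^sup>+\<xi>. ennreal ((norm (F k \<xi> - g \<xi>))\<^sup>2) \<partial>lebesgue)"
    by (rule nn_integral_liminf) measurable
  also have "\<dots> = 0" using lim by (intro lim_imp_Liminf) auto
  finally have "(\<integral>\<^sup>+\<xi>. ennreal ((norm (fourier_L1 f \<xi> - g \<xi>))\<^sup>2) \<partial>lebesgue) = 0" by simp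
  then have "AE \<xi> in lebesgue. ennreal ((norm (fourier_L1 f \<xi> - g \<xi>))\<^sup>2) = 0"
    by (subst (asm) nn_integral_0_iff_AE) auto
  then show ?thesis by eventually_elim simp
qed

text \<open>An interpolation between the bounds \<open>2\<close> and \<open>|x| |\<xi>|\<close>. The weight \<open>1 + |x|\<close> in place of \<open>|x|\<close>
  makes \<open>y\<close> positive for \<open>\<xi> \<noteq> 0\<close>, which keeps the case \<open>\<kappa> = 0\<close> from reading
  \<open>0 powr 0 = 0\<close> at \<open>x = 0\<close>.\<close>

lemma plane_wave_minus_one_le:
  fixes x \<xi> :: "real^'n"
  assumes "0 \<le> \<kappa>" "\<kappa> \<le> 1"
  shows "cmod (plane_wave \<xi> x - 1) \<le> 2 * norm \<xi> powr \<kappa> * (1 + norm x) powr \<kappa>"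
proof (cases "\<xi> = 0")
  case False
  define y where "y = (1 + norm x) * norm \<xi>"
  have y: "0 < y" using False by (simp add: y_def add_pos_nonneg)
  have eq: "norm \<xi> powr \<kappa> * (1 + norm x) powr \<kappa> = y powr \<kappa>"
    by (simp add: y_def powr_mult)
  have "cmod (plane_wave \<xi> x - 1) \<le> 2"
    using norm_triangle_ineq4[of "plane_wave \<xi> x" 1] unfolding norm_plane_wave by simp
  moreover have "cmod (plane_wave \<xi> x - 1) \<le> y"
  proof -
    have "cmod (plane_wave \<xi> x - 1) \<le> \<bar>x \<bullet> \<xi>\<bar>"
      using dist_exp_i_1[of "- (x \<bullet> \<xi>)"] abs_sin_x_le_abs_x[of "- (x \<bullet> \<xi>) / 2"] by simp
    also have "\<dots> \<le> norm x * norm \<xi>" by (rule Cauchy_Schwarz_ineq2)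
    also have "\<dots> \<le> y" by (simp add: y_def distrib_right)
    finally show ?thesis .
  qed
  moreover have "min 2 y \<le> 2 * y powr \<kappa>"
  proof (cases "y \<le> 1")
    case True
    then have "y powr 1 \<le> y powr \<kappa>" using assms y by (intro powr_mono') auto
    then show ?thesis using y powr_ge_zero[of y \<kappa>] by (simp add: min_def)
  next
    case False
    then show ?thesis using ge_one_powr_ge_zero[of y \<kappa>] assms by simp
  qed
  ultimately show ?thesis unfolding mult.assoc eq by linarith
qed simp

text \<open>Replacing the plane wave by \<open>1\<close> produces the total mass, and the error is controlled by the
  weighted \<open>L\<^sup>1\<close> norm. The normalising factor \<open>(2\<pi>)\<^bsup>-n/2\<^esup>\<close> is at most \<open>1\<close>.\<close>

lemma fourier_L1_bound:
  fixes f :: "real^'n \<Rightarrow> complex^'m"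
  assumes f: "f \<in> L1w \<kappa>" and k: "0 \<le> \<kappa>" "\<kappa> \<le> 1"
  shows "norm (fourier_L1 f \<xi>) \<le> 2 * norm \<xi> powr \<kappa> * L1w_norm \<kappa> f + norm (total_mass f)"
proof -
  have int: "integrable lebesgue f"
    and intw: "integrable lebesgue (\<lambda>x. (1 + norm x) powr \<kappa> * norm (f x))"
    using f by (auto simp: L1w_def)
  define I where "I = (LINT x|lebesgue. plane_wave \<xi> x *s f x)"
  have "I - total_mass f = (LINT x|lebesgue. plane_wave \<xi> x *s f x - f x)"
    unfolding I_def total_mass_def
    using integrable_plane_wave_smult[OF int] int by (rule Bochner_Integration.integral_diff[symmetric])
  also have "norm \<dots> \<le> (LINT x|lebesgue. 2 * norm \<xi> powr \<kappa> * ((1 + norm x) powr \<kappa> * norm (f x)))"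
  proof (rule Bochner_Integration.integral_norm_bound_integral)
    fix x :: "real^'n"
    have "plane_wave \<xi> x *s f x - f x = (plane_wave \<xi> x - 1) *s f x"
      by (simp add: vec_eq_iff algebra_simps)
    then have "norm (plane_wave \<xi> x *s f x - f x) = cmod (plane_wave \<xi> x - 1) * norm (f x)"
      by (simp only: norm_vector_smult)
    also have "\<dots> \<le> 2 * norm \<xi> powr \<kappa> * (1 + norm x) powr \<kappa> * norm (f x)"
      using k by (intro mult_right_mono plane_wave_minus_one_le) auto
    finally show "norm (plane_wave \<xi> x *s f x - f x)
        \<le> 2 * norm \<xi> powr \<kappa> * ((1 + norm x) powr \<kappa> * norm (f x))" by (simp add: mult.assoc)
  qed (use integrable_plane_wave_smult[OF int] int intw in auto)
  also have "\<dots> = 2 * norm \<xi> powr \<kappa> * L1w_norm \<kappa> f" by (simp add: L1w_norm_def)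
  finally have I: "norm I \<le> 2 * norm \<xi> powr \<kappa> * L1w_norm \<kappa> f + norm (total_mass f)"
    using norm_triangle_sub[of I "total_mass f"] by linarith
  have "(2 * pi) powr (- real CARD('n) / 2) \<le> (2 * pi) powr 0"
    using pi_gt3 by (intro powr_mono) auto
  then have "norm (fourier_L1 f \<xi>) \<le> norm I"
    using pi_gt_zero unfolding fourier_L1_def I_def[symmetric]
    by (auto intro!: mult_left_le_one_le)
  with I show ?thesis by linarith
qed

section \<open>Sobolev norms and splitting at the unit frequency\<close>

lemma laplace_symbol_eq:
  assumes "\<xi> \<noteq> 0"
  shows "laplace_symbol \<nu> \<xi> = norm \<xi> powr (2 * \<nu>)"
  using assms by (simp add: laplace_symbol_def)

lemma borel_measurable_laplace_symbol:
  "(laplace_symbol \<nu> :: real^'n \<Rightarrow> real) \<in> borel_measurable lebesgue"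
proof (rule measurable_completion)
  show "(laplace_symbol \<nu> :: real^'n \<Rightarrow> real) \<in> borel_measurable lborel"
    unfolding laplace_symbol_def[abs_def] by simp
qed

lemma borel_measurable_Bessel_weight:
  "(\<lambda>\<xi>::real^'n. (1 + (norm \<xi>)\<^sup>2) powr m) \<in> borel_measurable lebesgue"
  by (rule measurable_completion) auto

lemma AE_nonzero: "AE \<xi> in lebesgue. (\<xi>::real^'n) \<noteq> 0"
  by (rule AE_completion[OF AE_lborel_singleton])

lemma has_fourier_fourier: "has_fourier f g \<Longrightarrow> has_fourier f (fourier f)"
  unfolding fourier_def by (rule someI[of "has_fourier f"])

lemma norm_Bessel_weighted:
  fixes v :: "complex^'m"
  shows "(norm ((1 + (norm \<xi>)\<^sup>2) powr (m/2) *\<^sub>R v))\<^sup>2 = (1 + (norm \<xi>)\<^sup>2) powr m * (norm v)\<^sup>2"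
proof -
  have "1 + (norm \<xi>)\<^sup>2 > 0" by (simp add: add_pos_nonneg)
  then have "((1 + (norm \<xi>)\<^sup>2) powr (m/2))\<^sup>2 = (1 + (norm \<xi>)\<^sup>2) powr m"
    by (simp add: power2_eq_square powr_add[symmetric])
  then show ?thesis by (simp add: power_mult_distrib)
qed

lemma L2_norm_square:
  "(L2_norm f)\<^sup>2 = (LINT x|lebesgue. (norm (f x))\<^sup>2)"
  by (simp add: L2_norm_def)

lemma integrable_Bessel_weight:
  fixes f :: "real^'n \<Rightarrow> complex^'m"
  assumes f: "f \<in> Sobolev s" and g: "has_fourier f g" and "m \<le> s"
  shows "integrable lebesgue (\<lambda>\<xi>. (1 + (norm \<xi>)\<^sup>2) powr m * (norm (g \<xi>))\<^sup>2)"
proof -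
  from f obtain h where h: "has_fourier f h" "(\<lambda>\<xi>. (1 + (norm \<xi>)\<^sup>2) powr (s/2) *\<^sub>R h \<xi>) \<in> L2"
    by (auto simp: Sobolev_def)
  have [measurable]: "g \<in> borel_measurable lebesgue" using g by (simp add: has_fourier_def L2_def)
  show ?thesis
  proof (rule Bochner_Integration.integrable_bound)
    show "integrable lebesgue (\<lambda>\<xi>. (1 + (norm \<xi>)\<^sup>2) powr s * (norm (h \<xi>))\<^sup>2)"
      using h(2) by (simp add: L2_def norm_Bessel_weighted del: norm_scaleR)
    show "(\<lambda>\<xi>. (1 + (norm \<xi>)\<^sup>2) powr m * (norm (g \<xi>))\<^sup>2) \<in> borel_measurable lebesgue"
      by (intro borel_measurable_times borel_measurable_Bessel_weight) measurable
    show "AE \<xi> in lebesgue. norm ((1 + (norm \<xi>)\<^sup>2) powr m * (norm (g \<xi>))\<^sup>2)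
        \<le> norm ((1 + (norm \<xi>)\<^sup>2) powr s * (norm (h \<xi>))\<^sup>2)"
      using has_fourier_unique[OF g h(1)]
      by eventually_elim (auto intro!: mult_right_mono powr_mono \<open>m \<le> s\<close>)
  qed
qed

lemma Sobolev_norm_square:
  fixes f :: "real^'n \<Rightarrow> complex^'m"
  assumes g: "has_fourier f g"
  shows "(Sobolev_norm m f)\<^sup>2 = (LINT \<xi>|lebesgue. (1 + (norm \<xi>)\<^sup>2) powr m * (norm (g \<xi>))\<^sup>2)"
proof -
  have F: "has_fourier f (fourier f)" using g by (rule has_fourier_fourier)
  have [measurable]: "g \<in> borel_measurable lebesgue" "fourier f \<in> borel_measurable lebesgue"
    using g F by (auto simp: has_fourier_def L2_def)
  show ?thesis
    unfolding Sobolev_norm_def L2_norm_square norm_Bessel_weighted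
  proof (rule integral_cong_AE)
    show "AE \<xi> in lebesgue. (1 + (norm \<xi>)\<^sup>2) powr m * (norm (fourier f \<xi>))\<^sup>2
        = (1 + (norm \<xi>)\<^sup>2) powr m * (norm (g \<xi>))\<^sup>2"
      using fourier_AE_eq[OF g] by eventually_elim simp
  qed (intro borel_measurable_times borel_measurable_Bessel_weight; measurable)+
qed

lemma hom_Sobolev_norm_square:
  fixes f :: "real^'n \<Rightarrow> complex^'m"
  assumes g: "has_fourier f g"
  shows "(hom_Sobolev_norm m f)\<^sup>2 = (LINT \<xi>|lebesgue. (norm (laplace_symbol (m/2) \<xi> *\<^sub>R g \<xi>))\<^sup>2)"
proof -
  have F: "has_fourier f (fourier f)" using g by (rule has_fourier_fourier)
  have [measurable]: "g \<in> borel_measurable lebesgue" "fourier f \<in> borel_measurable lebesgue"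
      "laplace_symbol (m/2) \<in> borel_measurable (lebesgue :: (real^'n) measure)"
    using g F by (auto simp: has_fourier_def L2_def borel_measurable_laplace_symbol)
  show ?thesis
    unfolding hom_Sobolev_norm_def L2_norm_square
  proof (rule integral_cong_AE)
    show "AE \<xi> in lebesgue. (norm (laplace_symbol (m/2) \<xi> *\<^sub>R fourier f \<xi>))\<^sup>2
        = (norm (laplace_symbol (m/2) \<xi> *\<^sub>R g \<xi>))\<^sup>2"
      using fourier_AE_eq[OF g] by eventually_elim simp
  qed measurable
qed

text \<open>This isolates what the pointwise decay of \<open>g\<close> has to deliver: the heat-like factor
  \<open>exp (- |\<xi>|\<^sup>\<theta> t / 128)\<close> on the unit ball, and on its complement any bound \<open>H\<close> against the \<open>H\<^sup>m\<close>
  density of the datum. The constant depends on neither \<open>t\<close> nor \<open>H\<close> nor the functions, so \<open>H\<close> may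
  carry the time dependence.\<close>

lemma frequency_splitting:
  fixes s0 \<kappa> \<theta> :: real
  assumes "0 \<le> s0" and k: "0 \<le> \<kappa>" "\<kappa> \<le> 1" and "1 \<le> \<theta>"
  shows "\<exists>C>0. \<forall>t\<ge>0. \<forall>(f :: real^'n \<Rightarrow> complex^'m) (f0 :: real^'n \<Rightarrow> complex^'m) g g0 H m s.
    has_fourier f g \<longrightarrow> has_fourier f0 g0 \<longrightarrow> f0 \<in> L1w \<kappa> \<longrightarrow> f0 \<in> Sobolev s \<longrightarrow> m \<le> s \<longrightarrow> 0 \<le> H \<longrightarrow>
    (AE \<xi> in lebesgue. norm \<xi> \<le> 1 \<longrightarrow>
       (norm (g \<xi>))\<^sup>2 \<le> 8 * exp (- (1/128) * norm \<xi> powr \<theta> * t) * (norm (g0 \<xi>))\<^sup>2) \<longrightarrow>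
    (AE \<xi> in lebesgue. norm \<xi> > 1 \<longrightarrow>
       norm \<xi> powr (2 * s0) * (norm (g \<xi>))\<^sup>2 \<le> H\<^sup>2 * ((1 + (norm \<xi>)\<^sup>2) powr m * (norm (g0 \<xi>))\<^sup>2)) \<longrightarrow>
    f \<in> hom_Sobolev s0 \<and>
    hom_Sobolev_norm s0 f \<le>
      C * ((1 + t) powr (- (real CARD('n) + 2 * (s0 + \<kappa>)) / (2 * \<theta>)) * L1w_norm \<kappa> f0
        + H * Sobolev_norm m f0
        + (1 + t) powr (- (real CARD('n) + 2 * s0) / (2 * \<theta>)) * norm (total_mass f0))"
proof -
  define J where "J = (\<lambda>\<mu> t (\<xi>::real^'n). indicator (cball 0 1) \<xi> *
            (norm \<xi> powr (2 * \<mu>) * exp (- (1/128) * norm \<xi> powr \<theta> * t)) :: real)"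
  define n where "n = real CARD('n)"
  define \<tau> where "\<tau> = (\<lambda>\<mu> t. (1 + t) powr (- (n + 2 * \<mu>) / (2 * \<theta>)) :: real)"
  have tau_nonneg: "0 \<le> \<tau> \<mu> t" for \<mu> t by (simp add: \<tau>_def)
  have tau_square: "(\<tau> \<mu> t)\<^sup>2 = (1 + t) powr (- (n + 2 * \<mu>) / \<theta>)" if "t \<ge> 0" for \<mu> t
  proof -
    have "- (n + 2 * \<mu>) / (2 * \<theta>) + - (n + 2 * \<mu>) / (2 * \<theta>) = - (n + 2 * \<mu>) / \<theta>"
      by (simp add: field_simps)
    then show ?thesis by (simp only: \<tau>_def power2_eq_square powr_add[symmetric])
  qed
  have J: "\<exists>C>0. \<forall>t\<ge>0. integrable lebesgue (J \<mu> t) \<and> integral\<^sup>L lebesgue (J \<mu> t) \<le> C\<^sup>2 * (\<tau> \<mu> t)\<^sup>2"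
    if mu: "0 \<le> \<mu>" for \<mu>
  proof -
    obtain C where "C > 0" and C: "\<And>t. t \<ge> 0 \<Longrightarrow> integrable lebesgue (J \<mu> t)"
      "\<And>t. t \<ge> 0 \<Longrightarrow> integral\<^sup>L lebesgue (J \<mu> t) \<le> C * (1 + t) powr (- (n + 2 * \<mu>) / \<theta>)"
      using low_frequency_integral[OF mu \<open>1 \<le> \<theta>\<close>, of "1/128", where 'n = 'n] unfolding J_def n_def by auto
    then show ?thesis by (intro exI[of _ "sqrt C"]) (simp add: tau_square)
  qed
  obtain C1 where C1: "C1 > 0" "\<And>t. t \<ge> 0 \<Longrightarrow> integrable lebesgue (J (s0 + \<kappa>) t)"
      "\<And>t. t \<ge> 0 \<Longrightarrow> integral\<^sup>L lebesgue (J (s0 + \<kappa>) t) \<le> C1\<^sup>2 * (\<tau> (s0 + \<kappa>) t)\<^sup>2"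
    using J[of "s0 + \<kappa>"] assms by auto
  obtain C2 where C2: "C2 > 0" "\<And>t. t \<ge> 0 \<Longrightarrow> integrable lebesgue (J s0 t)"
      "\<And>t. t \<ge> 0 \<Longrightarrow> integral\<^sup>L lebesgue (J s0 t) \<le> C2\<^sup>2 * (\<tau> s0 t)\<^sup>2"
    using J[of s0] assms by auto
  define C where "C = 8 * C1 + 4 * C2 + 1"
  show ?thesis
  proof (intro exI[of _ C] conjI allI impI)
    show "0 < C" using C1(1) C2(1) by (simp add: C_def)
    fix t :: real and f f0 :: "real^'n \<Rightarrow> complex^'m" and g g0 :: "real^'n \<Rightarrow> complex^'m" and H m s :: real
    assume t: "t \<ge> 0" and g: "has_fourier f g" and g0: "has_fourier f0 g0"
      and f0: "f0 \<in> L1w \<kappa>" "f0 \<in> Sobolev s" and "m \<le> s" and H: "0 \<le> H"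
      and low: "AE \<xi> in lebesgue. norm \<xi> \<le> 1 \<longrightarrow>
       (norm (g \<xi>))\<^sup>2 \<le> 8 * exp (- (1/128) * norm \<xi> powr \<theta> * t) * (norm (g0 \<xi>))\<^sup>2"
      and high: "AE \<xi> in lebesgue. norm \<xi> > 1 \<longrightarrow>
       norm \<xi> powr (2 * s0) * (norm (g \<xi>))\<^sup>2 \<le> H\<^sup>2 * ((1 + (norm \<xi>)\<^sup>2) powr m * (norm (g0 \<xi>))\<^sup>2)"
    define M where "M = L1w_norm \<kappa> f0"
    define P where "P = norm (total_mass f0)"
    define S where "S = Sobolev_norm m f0"
    have M: "0 \<le> M" and P: "0 \<le> P" and S: "0 \<le> S"
      by (simp_all add: M_def P_def S_def L1w_norm_def Sobolev_norm_def L2_norm_def)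
    define G where "G = (\<lambda>\<xi>. (norm (laplace_symbol (s0/2) \<xi> *\<^sub>R g \<xi>))\<^sup>2)"
    \<comment> \<open>The squared low-frequency bound \<open>(2 |\<xi>|\<^sup>\<kappa> M + P)\<^sup>2 \<le> 8 |\<xi>|\<^bsup>2\<kappa>\<^esup> M\<^sup>2 + 2 P\<^sup>2\<close>, times the factor \<open>8\<close>,
      gives the coefficients \<open>64\<close> and \<open>16\<close>.\<close>
    define B where "B = (\<lambda>\<xi>. 64 * M\<^sup>2 * J (s0 + \<kappa>) t \<xi> + 16 * P\<^sup>2 * J s0 t \<xi>
        + H\<^sup>2 * ((1 + (norm \<xi>)\<^sup>2) powr m * (norm (g0 \<xi>))\<^sup>2))"
    have int: "integrable lebesgue (\<lambda>\<xi>. (1 + (norm \<xi>)\<^sup>2) powr m * (norm (g0 \<xi>))\<^sup>2)"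
      using f0(2) g0 \<open>m \<le> s\<close> by (rule integrable_Bessel_weight)
    have intB: "integrable lebesgue B"
      unfolding B_def using C1(2)[OF t] C2(2)[OF t] int by auto
    have [measurable]: "g \<in> borel_measurable lebesgue"
      using g by (simp add: has_fourier_def L2_def)
    have wg: "(\<lambda>\<xi>. laplace_symbol (s0/2) \<xi> *\<^sub>R g \<xi>) \<in> borel_measurable lebesgue"
      by (intro borel_measurable_scaleR borel_measurable_laplace_symbol) measurable
    have "integrable lebesgue f0" using f0(1) by (simp add: L1w_def)
    from has_fourier_eq_fourier_L1[OF g0 this] AE_nonzero low high
    have GB: "AE \<xi> in lebesgue. G \<xi> \<le> B \<xi>"
    proof eventually_elim
      case (elim \<xi>)
      have G: "G \<xi> = norm \<xi> powr (2 * s0) * (norm (g \<xi>))\<^sup>2"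
        using elim(2) by (simp add: G_def laplace_symbol_eq power_mult_distrib power2_eq_square
            powr_add[symmetric])
      show ?case
      proof (cases "norm \<xi> \<le> 1")
        case True
        define e where "e = exp (- (1/128) * norm \<xi> powr \<theta> * t)"
        have "norm (g0 \<xi>) \<le> 2 * norm \<xi> powr \<kappa> * M + P"
          unfolding elim(1) M_def P_def by (rule fourier_L1_bound[OF f0(1) k])
        then have "(norm (g0 \<xi>))\<^sup>2 \<le> (2 * norm \<xi> powr \<kappa> * M + P)\<^sup>2"
          by (intro power_mono) auto
        also have "\<dots> \<le> 2 * (2 * norm \<xi> powr \<kappa> * M)\<^sup>2 + 2 * P\<^sup>2"
          using zero_le_power2[of "2 * norm \<xi> powr \<kappa> * M - P"]
          by (simp add: power2_eq_square algebra_simps)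
        finally have g0b: "(norm (g0 \<xi>))\<^sup>2 \<le> 2 * (2 * norm \<xi> powr \<kappa> * M)\<^sup>2 + 2 * P\<^sup>2" .
        have "G \<xi> \<le> norm \<xi> powr (2 * s0) * (8 * e * (norm (g0 \<xi>))\<^sup>2)"
          unfolding G e_def using elim(3) True by (intro mult_left_mono) auto
        also have "\<dots> \<le> norm \<xi> powr (2 * s0) * (8 * e * (2 * (2 * norm \<xi> powr \<kappa> * M)\<^sup>2 + 2 * P\<^sup>2))"
          using g0b by (intro mult_left_mono) (auto simp: e_def)
        also have "\<dots> = 64 * M\<^sup>2 * (norm \<xi> powr (2 * (s0 + \<kappa>)) * e) + 16 * P\<^sup>2 * (norm \<xi> powr (2 * s0) * e)"
        proof -
          have "norm \<xi> powr (2 * (s0 + \<kappa>)) = norm \<xi> powr (2 * s0) * (norm \<xi> powr \<kappa>)\<^sup>2"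
            by (simp add: power2_eq_square powr_add[symmetric])
          then show ?thesis by (simp add: power_mult_distrib distrib_left mult_ac)
        qed
        also have "\<dots> \<le> B \<xi>"
          using True by (simp add: B_def J_def e_def)
        finally show ?thesis .
      next
        case False
        then have "G \<xi> \<le> H\<^sup>2 * ((1 + (norm \<xi>)\<^sup>2) powr m * (norm (g0 \<xi>))\<^sup>2)"
          unfolding G using elim(4) by simp
        also have "\<dots> = B \<xi>" using False by (simp add: B_def J_def)
        finally show ?thesis .
      qed
    qed
    have intG: "integrable lebesgue G"
    proof (rule Bochner_Integration.integrable_bound[OF intB])
      show "G \<in> borel_measurable lebesgue" unfolding G_def using wg by measurable
      show "AE \<xi> in lebesgue. norm (G \<xi>) \<le> norm (B \<xi>)"
        using GB by eventually_elim (auto simp: G_def)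
    qed
    then show "f \<in> hom_Sobolev s0"
      using g wg by (auto simp: hom_Sobolev_def L2_def G_def)
    define X where "X = 8 * C1 * \<tau> (s0 + \<kappa>) t * M"
    define Y where "Y = 4 * C2 * \<tau> s0 t * P"
    define Z where "Z = H * S"
    have XYZ: "0 \<le> X" "0 \<le> Y" "0 \<le> Z"
      using M P S H C1(1) C2(1) tau_nonneg by (auto simp: X_def Y_def Z_def)
    have "(hom_Sobolev_norm s0 f)\<^sup>2 = integral\<^sup>L lebesgue G"
      unfolding G_def by (rule hom_Sobolev_norm_square[OF g])
    also have "\<dots> \<le> integral\<^sup>L lebesgue B"
      by (rule integral_mono_AE[OF intG intB GB])
    also have "\<dots> = 64 * M\<^sup>2 * integral\<^sup>L lebesgue (J (s0 + \<kappa>) t)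
        + 16 * P\<^sup>2 * integral\<^sup>L lebesgue (J s0 t) + H\<^sup>2 * S\<^sup>2"
      unfolding B_def S_def Sobolev_norm_square[OF g0]
      using C1(2)[OF t] C2(2)[OF t] int by simp
    also have "\<dots> \<le> 64 * M\<^sup>2 * (C1\<^sup>2 * (\<tau> (s0 + \<kappa>) t)\<^sup>2)
        + 16 * P\<^sup>2 * (C2\<^sup>2 * (\<tau> s0 t)\<^sup>2) + H\<^sup>2 * S\<^sup>2"
      using C1(3)[OF t] C2(3)[OF t] by (intro add_mono mult_left_mono) auto
    also have "\<dots> = X\<^sup>2 + Y\<^sup>2 + Z\<^sup>2"
      by (simp add: X_def Y_def Z_def power_mult_distrib)
    also have "\<dots> \<le> (X + Y + Z)\<^sup>2"
      using XYZ by (simp add: power2_eq_square algebra_simps)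
    finally have "hom_Sobolev_norm s0 f \<le> X + Y + Z"
      by (rule power2_le_imp_le) (use XYZ in auto)
    also have "\<dots> \<le> C * (\<tau> (s0 + \<kappa>) t * M) + C * (\<tau> s0 t * P) + C * (H * S)"
    proof -
      have C: "8 * C1 \<le> C" "4 * C2 \<le> C" "1 \<le> C"
        using C1(1) C2(1) by (simp_all add: C_def)
      have "X \<le> C * (\<tau> (s0 + \<kappa>) t * M)"
        unfolding X_def mult.assoc[of _ "\<tau> _ _"] using C M tau_nonneg by (intro mult_right_mono) auto
      moreover have "Y \<le> C * (\<tau> s0 t * P)"
        unfolding Y_def mult.assoc[of _ "\<tau> _ _"] using C P tau_nonneg by (intro mult_right_mono) auto
      moreover have "1 * Z \<le> C * (H * S)"
        unfolding Z_def[symmetric] using C XYZ by (intro mult_right_mono) auto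
      ultimately show ?thesis by simp
    qed
    finally show "hom_Sobolev_norm s0 f \<le>
      C * ((1 + t) powr (- (real CARD('n) + 2 * (s0 + \<kappa>)) / (2 * \<theta>)) * L1w_norm \<kappa> f0
        + H * Sobolev_norm m f0
        + (1 + t) powr (- (real CARD('n) + 2 * s0) / (2 * \<theta>)) * norm (total_mass f0))"
      by (simp add: \<tau>_def n_def M_def P_def S_def algebra_simps)
  qed
qed

section \<open>Decay estimates for solutions\<close>

text \<open>The case distinction in the Laplace symbol disappears away from \<open>\<xi> = 0\<close>, which is a null
  set. The rate \<open>r\<close> is left free because the low and the high frequencies use different lower
  bounds for the minimum of the two powers.\<close>

lemma solution_frequency_decay:
  fixes w0 :: "real^'n \<Rightarrow> complex^3" and \<sigma> :: real
  assumes "\<sigma> \<ge> 1" and "is_solution \<sigma> \<alpha> w0 w"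
  obtains W where "\<And>t. t \<ge> 0 \<Longrightarrow> has_fourier (w t) (W t)" and "has_fourier w0 (W 0)"
    and "AE \<xi> in lebesgue. \<forall>t\<ge>0. \<forall>r. r \<le> norm \<xi> powr (2 * \<sigma> - 2 * \<sigma> * \<alpha>) \<longrightarrow>
          r \<le> norm \<xi> powr (6 * \<sigma> * \<alpha> - 2 * \<sigma>) \<longrightarrow>
          (norm (W t \<xi>))\<^sup>2 \<le> 8 * exp (- r / 128 * t) * (norm (W 0 \<xi>))\<^sup>2"
proof -
  from assms(2) obtain W where W: "\<forall>t\<ge>0. has_fourier (w t) (W t)" "has_fourier w0 (W 0)"
     "AE \<xi> in lebesgue. continuous_on {0..} (\<lambda>t. W t \<xi>) \<and>
        (\<forall>t>0. ((\<lambda>t. W t \<xi>) has_vector_derivative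
           (laplace_symbol (\<sigma>/2) \<xi> *\<^sub>R B0 + laplace_symbol (\<sigma> * \<alpha>) \<xi> *\<^sub>R B1) *v W t \<xi>) (at t))"
    unfolding is_solution_def by blast
  show ?thesis
  proof (rule that[of W])
    show "AE \<xi> in lebesgue. \<forall>t\<ge>0. \<forall>r. r \<le> norm \<xi> powr (2 * \<sigma> - 2 * \<sigma> * \<alpha>) \<longrightarrow>
          r \<le> norm \<xi> powr (6 * \<sigma> * \<alpha> - 2 * \<sigma>) \<longrightarrow>
          (norm (W t \<xi>))\<^sup>2 \<le> 8 * exp (- r / 128 * t) * (norm (W 0 \<xi>))\<^sup>2"
      using W(3) AE_nonzero
    proof eventually_elim
      case (elim \<xi>)
      define a where "a = norm \<xi> powr \<sigma>"
      define b where "b = norm \<xi> powr (2 * \<sigma> * \<alpha>)"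
      have ab: "0 < a" "0 < b" using elim(2) by (auto simp: a_def b_def)
      have sym: "laplace_symbol (\<sigma>/2) \<xi> = a" "laplace_symbol (\<sigma> * \<alpha>) \<xi> = b"
        using elim(2) by (auto simp: a_def b_def laplace_symbol_eq mult.assoc)
      have "a\<^sup>2 / b = norm \<xi> powr (2 * \<sigma> - 2 * \<sigma> * \<alpha>)"
        by (simp add: a_def b_def power2_eq_square powr_add[symmetric] powr_diff[symmetric] mult_ac)
      moreover have "b ^ 3 / a\<^sup>2 = norm \<xi> powr (6 * \<sigma> * \<alpha> - 2 * \<sigma>)"
        by (simp add: a_def b_def power2_eq_square power3_eq_cube powr_add[symmetric] powr_diff[symmetric] mult_ac)
      ultimately show ?case
        using symbol_flow_decay[of "\<lambda>t. W t \<xi>", OF _ _ ab] elim(1) unfolding sym by auto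
    qed
  qed (use W in auto)
qed

lemma powr_double_le_Bessel_weight:
  fixes r m :: real assumes "0 \<le> m" "0 < r"
  shows "r powr (2 * m) \<le> (1 + r\<^sup>2) powr m"
proof -
  have "r powr (2 * m) = (r\<^sup>2) powr m"
    using assms by (simp add: powr_powr flip: powr_numeral)
  also have "\<dots> \<le> (1 + r\<^sup>2) powr m" using assms by (intro powr_mono2) auto
  finally show ?thesis .
qed

lemma low_frequency_rate:
  fixes r :: real
  assumes "0 < r" "r \<le> 1" "\<theta> = max (2 * \<sigma> - 2 * \<sigma> * \<alpha>) (6 * \<sigma> * \<alpha> - 2 * \<sigma>)"
  shows "r powr \<theta> \<le> r powr (2 * \<sigma> - 2 * \<sigma> * \<alpha>)" "r powr \<theta> \<le> r powr (6 * \<sigma> * \<alpha> - 2 * \<sigma>)"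
  using assms by (auto intro: powr_mono')

text \<open>All three ranges of \<open>\<alpha>\<close> are instances: they differ only in the value of the maximum \<open>\<theta>\<close> and in
  the profile \<open>h\<close> that the high frequencies admit.\<close>

lemma solution_decay:
  fixes \<sigma> \<alpha> s0 \<kappa> s \<theta> K m :: real and h :: "real \<Rightarrow> real"
  assumes "\<sigma> \<ge> 1" "0 \<le> s0" "m \<le> s" "0 \<le> \<kappa>" "\<kappa> \<le> 1"
    and theta: "1 \<le> \<theta>" "\<theta> = max (2 * \<sigma> - 2 * \<sigma> * \<alpha>) (6 * \<sigma> * \<alpha> - 2 * \<sigma>)"
    and K: "0 \<le> K" and h: "\<And>t. 0 \<le> h t"
    and high: "\<And>r t. 1 < r \<Longrightarrow> 0 \<le> t \<Longrightarrow> \<exists>\<rho>. \<rho> \<le> r powr (2 * \<sigma> - 2 * \<sigma> * \<alpha>) \<and>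
        \<rho> \<le> r powr (6 * \<sigma> * \<alpha> - 2 * \<sigma>) \<and>
        r powr (2 * s0) * (8 * exp (- \<rho> / 128 * t)) \<le> (K * h t)\<^sup>2 * (1 + r\<^sup>2) powr m"
  shows "\<exists>C>0. \<forall>(w0 :: real^'n \<Rightarrow> complex^3) w.
    w0 \<in> Sobolev s \<inter> L1w \<kappa> \<and> is_solution \<sigma> \<alpha> w0 w \<longrightarrow>
    (\<forall>t\<ge>0. w t \<in> hom_Sobolev s0 \<and> hom_Sobolev_norm s0 (w t) \<le>
      C * ((1 + t) powr (- (real CARD('n) + 2 * (s0 + \<kappa>)) / (2 * \<theta>)) * L1w_norm \<kappa> w0
        + h t * Sobolev_norm m w0
        + (1 + t) powr (- (real CARD('n) + 2 * s0) / (2 * \<theta>)) * norm (total_mass w0)))"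
proof -
  obtain C where C: "C > 0" and est: "\<forall>t\<ge>0. \<forall>(f :: real^'n \<Rightarrow> complex^3) (f0 :: real^'n \<Rightarrow> complex^3) g g0 H m s.
    has_fourier f g \<longrightarrow> has_fourier f0 g0 \<longrightarrow> f0 \<in> L1w \<kappa> \<longrightarrow> f0 \<in> Sobolev s \<longrightarrow> m \<le> s \<longrightarrow> 0 \<le> H \<longrightarrow>
    (AE \<xi> in lebesgue. norm \<xi> \<le> 1 \<longrightarrow>
       (norm (g \<xi>))\<^sup>2 \<le> 8 * exp (- (1/128) * norm \<xi> powr \<theta> * t) * (norm (g0 \<xi>))\<^sup>2) \<longrightarrow>
    (AE \<xi> in lebesgue. norm \<xi> > 1 \<longrightarrow>
       norm \<xi> powr (2 * s0) * (norm (g \<xi>))\<^sup>2 \<le> H\<^sup>2 * ((1 + (norm \<xi>)\<^sup>2) powr m * (norm (g0 \<xi>))\<^sup>2)) \<longrightarrow>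
    f \<in> hom_Sobolev s0 \<and>
    hom_Sobolev_norm s0 f \<le>
      C * ((1 + t) powr (- (real CARD('n) + 2 * (s0 + \<kappa>)) / (2 * \<theta>)) * L1w_norm \<kappa> f0
        + H * Sobolev_norm m f0
        + (1 + t) powr (- (real CARD('n) + 2 * s0) / (2 * \<theta>)) * norm (total_mass f0))"
    using frequency_splitting[OF \<open>0 \<le> s0\<close> \<open>0 \<le> \<kappa>\<close> \<open>\<kappa> \<le> 1\<close> theta(1), where 'n = 'n and 'm = 3]
    by (elim exE conjE) (rule that)
  show ?thesis
  proof (intro exI[of _ "C * (1 + K)"] conjI allI impI; (elim conjE IntE)?)
    show "0 < C * (1 + K)" using C K by simp
  next
    fix w0 :: "real^'n \<Rightarrow> complex^3" and w and t :: real
    assume w0: "w0 \<in> Sobolev s" "w0 \<in> L1w \<kappa>" and sol: "is_solution \<sigma> \<alpha> w0 w" and t: "0 \<le> t"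
    obtain W where W: "\<And>t. t \<ge> 0 \<Longrightarrow> has_fourier (w t) (W t)" "has_fourier w0 (W 0)"
      and decay: "AE \<xi> in lebesgue. \<forall>t\<ge>0. \<forall>r. r \<le> norm \<xi> powr (2 * \<sigma> - 2 * \<sigma> * \<alpha>) \<longrightarrow>
          r \<le> norm \<xi> powr (6 * \<sigma> * \<alpha> - 2 * \<sigma>) \<longrightarrow>
          (norm (W t \<xi>))\<^sup>2 \<le> 8 * exp (- r / 128 * t) * (norm (W 0 \<xi>))\<^sup>2"
      using solution_frequency_decay[OF \<open>\<sigma> \<ge> 1\<close> sol] by blast
    have "AE \<xi> in lebesgue. norm \<xi> \<le> 1 \<longrightarrow>
       (norm (W t \<xi>))\<^sup>2 \<le> 8 * exp (- (1/128) * norm \<xi> powr \<theta> * t) * (norm (W 0 \<xi>))\<^sup>2"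
      using decay AE_nonzero
    proof eventually_elim
      case (elim \<xi>)
      show ?case
      proof
        assume "norm \<xi> \<le> 1"
        from low_frequency_rate[OF _ this theta(2)] elim(2)
        have "norm \<xi> powr \<theta> \<le> norm \<xi> powr (2 * \<sigma> - 2 * \<sigma> * \<alpha>)"
          "norm \<xi> powr \<theta> \<le> norm \<xi> powr (6 * \<sigma> * \<alpha> - 2 * \<sigma>)" by auto
        with elim(1) t have "(norm (W t \<xi>))\<^sup>2 \<le> 8 * exp (- (norm \<xi> powr \<theta>) / 128 * t) * (norm (W 0 \<xi>))\<^sup>2"
          by blast
        then show "(norm (W t \<xi>))\<^sup>2 \<le> 8 * exp (- (1/128) * norm \<xi> powr \<theta> * t) * (norm (W 0 \<xi>))\<^sup>2"
          by simp
      qed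
    qed
    moreover have "AE \<xi> in lebesgue. norm \<xi> > 1 \<longrightarrow> norm \<xi> powr (2 * s0) * (norm (W t \<xi>))\<^sup>2
        \<le> (K * h t)\<^sup>2 * ((1 + (norm \<xi>)\<^sup>2) powr m * (norm (W 0 \<xi>))\<^sup>2)"
      using decay
    proof eventually_elim
      case (elim \<xi>)
      show ?case
      proof
        assume "1 < norm \<xi>"
        from high[OF this t] obtain \<rho> where rho: "\<rho> \<le> norm \<xi> powr (2 * \<sigma> - 2 * \<sigma> * \<alpha>)"
            "\<rho> \<le> norm \<xi> powr (6 * \<sigma> * \<alpha> - 2 * \<sigma>)"
          and *: "norm \<xi> powr (2 * s0) * (8 * exp (- \<rho> / 128 * t))
            \<le> (K * h t)\<^sup>2 * (1 + (norm \<xi>)\<^sup>2) powr m" by blast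
        have "norm \<xi> powr (2 * s0) * (norm (W t \<xi>))\<^sup>2
            \<le> norm \<xi> powr (2 * s0) * (8 * exp (- \<rho> / 128 * t) * (norm (W 0 \<xi>))\<^sup>2)"
          using elim t rho by (intro mult_left_mono) auto
        also have "\<dots> = norm \<xi> powr (2 * s0) * (8 * exp (- \<rho> / 128 * t)) * (norm (W 0 \<xi>))\<^sup>2"
          by (simp only: mult.assoc)
        also have "\<dots> \<le> (K * h t)\<^sup>2 * (1 + (norm \<xi>)\<^sup>2) powr m * (norm (W 0 \<xi>))\<^sup>2"
          using * by (rule mult_right_mono) simp
        finally show "norm \<xi> powr (2 * s0) * (norm (W t \<xi>))\<^sup>2
            \<le> (K * h t)\<^sup>2 * ((1 + (norm \<xi>)\<^sup>2) powr m * (norm (W 0 \<xi>))\<^sup>2)"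
          by (simp only: mult.assoc)
      qed
    qed
    moreover have "0 \<le> K * h t" using K h by simp
    ultimately have main: "w t \<in> hom_Sobolev s0 \<and> hom_Sobolev_norm s0 (w t) \<le>
      C * ((1 + t) powr (- (real CARD('n) + 2 * (s0 + \<kappa>)) / (2 * \<theta>)) * L1w_norm \<kappa> w0
        + (K * h t) * Sobolev_norm m w0
        + (1 + t) powr (- (real CARD('n) + 2 * s0) / (2 * \<theta>)) * norm (total_mass w0))"
      using est t W(1)[OF t] W(2) w0 \<open>m \<le> s\<close> by blast
    then show "w t \<in> hom_Sobolev s0" ..
    define A where "A = (1 + t) powr (- (real CARD('n) + 2 * (s0 + \<kappa>)) / (2 * \<theta>)) * L1w_norm \<kappa> w0"
    define D where "D = (1 + t) powr (- (real CARD('n) + 2 * s0) / (2 * \<theta>)) * norm (total_mass w0)"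
    define S where "S = h t * Sobolev_norm m w0"
    have "0 \<le> A" "0 \<le> D" "0 \<le> S"
      using h by (auto simp: A_def D_def S_def L1w_norm_def Sobolev_norm_def L2_norm_def)
    then have "A + K * S + D \<le> (1 + K) * (A + S + D)"
      using K by (simp add: algebra_simps)
    then have "C * (A + K * S + D) \<le> C * ((1 + K) * (A + S + D))"
      using C by (intro mult_left_mono) auto
    with main show "hom_Sobolev_norm s0 (w t) \<le> C * (1 + K) *
      ((1 + t) powr (- (real CARD('n) + 2 * (s0 + \<kappa>)) / (2 * \<theta>)) * L1w_norm \<kappa> w0
        + h t * Sobolev_norm m w0
        + (1 + t) powr (- (real CARD('n) + 2 * s0) / (2 * \<theta>)) * norm (total_mass w0))"
      unfolding A_def[symmetric] D_def[symmetric] mult.assoc[of K] S_def[symmetric] mult.assoc[of C]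
      by linarith
  qed
qed

text \<open>Both exponents are nonnegative, so the rate is at least \<open>1\<close>. After taking square roots this
  leaves the decay constant \<open>1/256\<close>, whatever the parameters.\<close>

lemma high_frequency_exponential:
  fixes r t s0 \<sigma> \<alpha> :: real
  assumes "1 < r" "0 \<le> t" "0 \<le> s0" "0 \<le> \<sigma>" "1/3 \<le> \<alpha>" "\<alpha> \<le> 1"
  shows "\<exists>\<rho>. \<rho> \<le> r powr (2 * \<sigma> - 2 * \<sigma> * \<alpha>) \<and> \<rho> \<le> r powr (6 * \<sigma> * \<alpha> - 2 * \<sigma>) \<and>
    r powr (2 * s0) * (8 * exp (- \<rho> / 128 * t)) \<le> (3 * exp (- (1/256) * t))\<^sup>2 * (1 + r\<^sup>2) powr s0"
proof (intro exI[of _ 1] conjI)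
  have "0 \<le> 2 * \<sigma> * (1 - \<alpha>)" "0 \<le> 2 * \<sigma> * (3 * \<alpha> - 1)" using assms by auto
  then show "1 \<le> r powr (2 * \<sigma> - 2 * \<sigma> * \<alpha>)" "1 \<le> r powr (6 * \<sigma> * \<alpha> - 2 * \<sigma>)"
    using assms(1) by (auto intro!: ge_one_powr_ge_zero simp: algebra_simps)
  have e: "(3 * exp (- (1/256) * t))\<^sup>2 = 9 * exp (- 1 / 128 * t)"
    by (simp add: power_mult_distrib exp_double[symmetric])
  have "r powr (2 * s0) * (8 * exp (- 1 / 128 * t)) \<le> (1 + r\<^sup>2) powr s0 * (9 * exp (- 1 / 128 * t))"
    using assms by (intro mult_mono powr_double_le_Bessel_weight) auto
  then show "r powr (2 * s0) * (8 * exp (- 1 / 128 * t)) \<le> (3 * exp (- (1/256) * t))\<^sup>2 * (1 + r\<^sup>2) powr s0"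
    unfolding e by (simp only: mult.commute)
qed

text \<open>With \<open>\<eta> = 2\<sigma>(1 - 3\<alpha>)\<close> and the rate \<open>y = r\<^bsup>-\<eta>\<^esup>\<close>, the identity \<open>r\<^bsup>-2l\<^esup> = y\<^bsup>2l/\<eta>\<^esup>\<close> trades the
  weight \<open>r\<^bsup>2l\<^esup>\<close> of the datum for a power of \<open>y\<close>, and the latter is converted into decay in time.\<close>

lemma high_frequency_regularity_loss:
  fixes s0 \<sigma> \<alpha> l :: real
  assumes "0 \<le> s0" "0 \<le> l" "0 < \<sigma>" "\<alpha> < 1/3"
  obtains K where "K > 0" and "\<And>r t. 1 < r \<Longrightarrow> 0 \<le> t \<Longrightarrow> \<exists>\<rho>. \<rho> \<le> r powr (2 * \<sigma> - 2 * \<sigma> * \<alpha>) \<and>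
    \<rho> \<le> r powr (6 * \<sigma> * \<alpha> - 2 * \<sigma>) \<and>
    r powr (2 * s0) * (8 * exp (- \<rho> / 128 * t))
      \<le> (K * (1 + t) powr (- l / (2 * \<sigma> * (1 - 3 * \<alpha>))))\<^sup>2 * (1 + r\<^sup>2) powr (s0 + l)"
proof -
  define \<eta> where "\<eta> = 2 * \<sigma> * (1 - 3 * \<alpha>)"
  have eta: "0 < \<eta>" using assms by (simp add: \<eta>_def)
  obtain K where K: "K > 0" "\<And>y t. 0 < y \<Longrightarrow> y \<le> 1 \<Longrightarrow> 0 \<le> t \<Longrightarrow>
      y powr (2 * l / \<eta>) * exp (- (1/128) * y * t) \<le> K * (1 + t) powr (- (2 * l / \<eta>))"
    using powr_exp_time_decay[of "2 * l / \<eta>" "1/128"] assms eta by auto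
  show ?thesis
  proof (rule that[of "sqrt (8 * K)"])
    show "0 < sqrt (8 * K)" using K(1) by simp
    fix r t :: real assume r: "1 < r" and t: "0 \<le> t"
    define y where "y = r powr (- \<eta>)"
    have y: "0 < y" "y \<le> 1" using r eta powr_mono[of "- \<eta>" 0 r] by (auto simp: y_def)
    have yl: "y powr (2 * l / \<eta>) = r powr (- (2 * l))"
      using eta by (simp add: y_def powr_powr)
    have sq: "(sqrt (8 * K) * (1 + t) powr (- l / \<eta>))\<^sup>2 = 8 * K * (1 + t) powr (- (2 * l / \<eta>))"
      using K(1) by (simp add: power_mult_distrib power2_eq_square[of "_ powr _"] powr_add[symmetric])
    have "r powr (2 * s0) * (8 * exp (- y / 128 * t))
        = r powr (2 * (s0 + l)) * (8 * (y powr (2 * l / \<eta>) * exp (- (1/128) * y * t)))"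
      using r unfolding yl by (simp add: powr_add powr_minus distrib_left)
    also have "\<dots> \<le> (1 + r\<^sup>2) powr (s0 + l) * (8 * (K * (1 + t) powr (- (2 * l / \<eta>))))"
      using assms r t y by (intro mult_mono mult_left_mono K(2) powr_double_le_Bessel_weight) auto
    finally have "r powr (2 * s0) * (8 * exp (- y / 128 * t))
        \<le> (sqrt (8 * K) * (1 + t) powr (- l / \<eta>))\<^sup>2 * (1 + r\<^sup>2) powr (s0 + l)"
      unfolding sq by (simp add: mult_ac)
    moreover have "y \<le> r powr (6 * \<sigma> * \<alpha> - 2 * \<sigma>)"
      by (simp add: y_def \<eta>_def algebra_simps)
    moreover have "y \<le> r powr (2 * \<sigma> - 2 * \<sigma> * \<alpha>)"
    proof -
      have "0 \<le> 4 * \<sigma> * (1 - 2 * \<alpha>)" using assms by auto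
      then have "- \<eta> \<le> 2 * \<sigma> - 2 * \<sigma> * \<alpha>"
        using assms mult_nonneg_nonneg[of \<sigma> "1 - 2 * \<alpha>"] by (simp add: \<eta>_def algebra_simps)
      then show ?thesis using r unfolding y_def by (intro powr_mono) auto
    qed
    ultimately show "\<exists>\<rho>. \<rho> \<le> r powr (2 * \<sigma> - 2 * \<sigma> * \<alpha>) \<and>
      \<rho> \<le> r powr (6 * \<sigma> * \<alpha> - 2 * \<sigma>) \<and>
      r powr (2 * s0) * (8 * exp (- \<rho> / 128 * t))
        \<le> (sqrt (8 * K) * (1 + t) powr (- l / (2 * \<sigma> * (1 - 3 * \<alpha>))))\<^sup>2 * (1 + r\<^sup>2) powr (s0 + l)"
      unfolding \<eta>_def by blast
  qed
qed

theorem theorem3p1: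
  fixes \<sigma> \<alpha> s \<kappa> :: real
  assumes "\<sigma> \<ge> 1" and "0 \<le> \<alpha>" and "\<alpha> \<le> 1" and "s \<ge> 0" and "0 \<le> \<kappa>" and "\<kappa> \<le> 1"
  shows "\<exists>c>0. \<forall>s0 l. s0 \<ge> 0 \<and> l \<ge> 0 \<and> s0 + l \<le> s \<longrightarrow>
    (\<exists>C>0. \<forall>(w0 :: real^'n \<Rightarrow> complex^3) w.
       w0 \<in> Sobolev s \<inter> L1w \<kappa> \<and> is_solution \<sigma> \<alpha> w0 w \<longrightarrow>
       (\<forall>t\<ge>0. w t \<in> hom_Sobolev s0 \<and>
         (\<alpha> < 1/3 \<longrightarrow>
            hom_Sobolev_norm s0 (w t) \<le> C *
              ((1 + t) powr (- (real CARD('n) + 2 * (s0 + \<kappa>)) / (2 * (2 * \<sigma> - 2 * \<sigma> * \<alpha>)))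
                 * L1w_norm \<kappa> w0
             + (1 + t) powr (- l / (2 * \<sigma> * (1 - 3 * \<alpha>))) * Sobolev_norm (s0 + l) w0
             + (1 + t) powr (- (real CARD('n) + 2 * s0) / (2 * (2 * \<sigma> - 2 * \<sigma> * \<alpha>)))
                 * norm (total_mass w0))) \<and>
         (1/3 \<le> \<alpha> \<and> \<alpha> \<le> 1/2 \<longrightarrow>
            hom_Sobolev_norm s0 (w t) \<le> C *
              ((1 + t) powr (- (real CARD('n) + 2 * (s0 + \<kappa>)) / (2 * (2 * \<sigma> - 2 * \<sigma> * \<alpha>)))
                 * L1w_norm \<kappa> w0
             + exp (- c * t) * Sobolev_norm s0 w0
             + (1 + t) powr (- (real CARD('n) + 2 * s0) / (2 * (2 * \<sigma> - 2 * \<sigma> * \<alpha>)))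
                 * norm (total_mass w0))) \<and>
         (1/2 < \<alpha> \<longrightarrow>
            hom_Sobolev_norm s0 (w t) \<le> C *
              ((1 + t) powr (- (real CARD('n) + 2 * (s0 + \<kappa>)) / (2 * (6 * \<sigma> * \<alpha> - 2 * \<sigma>)))
                 * L1w_norm \<kappa> w0
             + exp (- c * t) * Sobolev_norm s0 w0
             + (1 + t) powr (- (real CARD('n) + 2 * s0) / (2 * (6 * \<sigma> * \<alpha> - 2 * \<sigma>)))
                 * norm (total_mass w0)))))"
proof (rule exI[of _ "1/256"], intro conjI allI impI; (elim conjE)?)
  show "0 < (1/256::real)" by simp
next
  fix s0 l :: real assume s0: "0 \<le> s0" and l: "0 \<le> l" and sum: "s0 + l \<le> s"
  have "s0 \<le> s" using l sum by simp
  have theta_low: "max (2 * \<sigma> - 2 * \<sigma> * \<alpha>) (6 * \<sigma> * \<alpha> - 2 * \<sigma>) = 2 * \<sigma> - 2 * \<sigma> * \<alpha>"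
      "1 \<le> 2 * \<sigma> - 2 * \<sigma> * \<alpha>" if "\<alpha> \<le> 1/2"
  proof -
    have "\<sigma> * \<alpha> \<le> \<sigma> * (1/2)" using that assms by (intro mult_left_mono) auto
    with \<open>\<sigma> \<ge> 1\<close> show "max (2 * \<sigma> - 2 * \<sigma> * \<alpha>) (6 * \<sigma> * \<alpha> - 2 * \<sigma>) = 2 * \<sigma> - 2 * \<sigma> * \<alpha>"
      "1 \<le> 2 * \<sigma> - 2 * \<sigma> * \<alpha>" by linarith+
  qed
  have theta_high: "max (2 * \<sigma> - 2 * \<sigma> * \<alpha>) (6 * \<sigma> * \<alpha> - 2 * \<sigma>) = 6 * \<sigma> * \<alpha> - 2 * \<sigma>"
      "1 \<le> 6 * \<sigma> * \<alpha> - 2 * \<sigma>" if "1/2 < \<alpha>"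
  proof -
    have "\<sigma> * (1/2) \<le> \<sigma> * \<alpha>" using that assms by (intro mult_left_mono) auto
    with \<open>\<sigma> \<ge> 1\<close> show "max (2 * \<sigma> - 2 * \<sigma> * \<alpha>) (6 * \<sigma> * \<alpha> - 2 * \<sigma>) = 6 * \<sigma> * \<alpha> - 2 * \<sigma>"
      "1 \<le> 6 * \<sigma> * \<alpha> - 2 * \<sigma>" by linarith+
  qed
  consider "\<alpha> < 1/3" | "1/3 \<le> \<alpha>" "\<alpha> \<le> 1/2" | "1/2 < \<alpha>" by linarith
  then show "\<exists>C>0. \<forall>(w0 :: real^'n \<Rightarrow> complex^3) w.
       w0 \<in> Sobolev s \<inter> L1w \<kappa> \<and> is_solution \<sigma> \<alpha> w0 w \<longrightarrow>
       (\<forall>t\<ge>0. w t \<in> hom_Sobolev s0 \<and>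
         (\<alpha> < 1/3 \<longrightarrow>
            hom_Sobolev_norm s0 (w t) \<le> C *
              ((1 + t) powr (- (real CARD('n) + 2 * (s0 + \<kappa>)) / (2 * (2 * \<sigma> - 2 * \<sigma> * \<alpha>)))
                 * L1w_norm \<kappa> w0
             + (1 + t) powr (- l / (2 * \<sigma> * (1 - 3 * \<alpha>))) * Sobolev_norm (s0 + l) w0
             + (1 + t) powr (- (real CARD('n) + 2 * s0) / (2 * (2 * \<sigma> - 2 * \<sigma> * \<alpha>)))
                 * norm (total_mass w0))) \<and>
         (1/3 \<le> \<alpha> \<and> \<alpha> \<le> 1/2 \<longrightarrow>
            hom_Sobolev_norm s0 (w t) \<le> C *
              ((1 + t) powr (- (real CARD('n) + 2 * (s0 + \<kappa>)) / (2 * (2 * \<sigma> - 2 * \<sigma> * \<alpha>)))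
                 * L1w_norm \<kappa> w0
             + exp (- (1/256) * t) * Sobolev_norm s0 w0
             + (1 + t) powr (- (real CARD('n) + 2 * s0) / (2 * (2 * \<sigma> - 2 * \<sigma> * \<alpha>)))
                 * norm (total_mass w0))) \<and>
         (1/2 < \<alpha> \<longrightarrow>
            hom_Sobolev_norm s0 (w t) \<le> C *
              ((1 + t) powr (- (real CARD('n) + 2 * (s0 + \<kappa>)) / (2 * (6 * \<sigma> * \<alpha> - 2 * \<sigma>)))
                 * L1w_norm \<kappa> w0
             + exp (- (1/256) * t) * Sobolev_norm s0 w0
             + (1 + t) powr (- (real CARD('n) + 2 * s0) / (2 * (6 * \<sigma> * \<alpha> - 2 * \<sigma>)))
                 * norm (total_mass w0))))"
  proof cases
    case 1
    obtain K where K: "K > 0" "\<And>r t. 1 < r \<Longrightarrow> 0 \<le> t \<Longrightarrow> \<exists>\<rho>. \<rho> \<le> r powr (2 * \<sigma> - 2 * \<sigma> * \<alpha>) \<and>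
      \<rho> \<le> r powr (6 * \<sigma> * \<alpha> - 2 * \<sigma>) \<and>
      r powr (2 * s0) * (8 * exp (- \<rho> / 128 * t))
        \<le> (K * (1 + t) powr (- l / (2 * \<sigma> * (1 - 3 * \<alpha>))))\<^sup>2 * (1 + r\<^sup>2) powr (s0 + l)"
      by (rule high_frequency_regularity_loss[OF s0 l _ 1, of \<sigma>]) (use \<open>\<sigma> \<ge> 1\<close> in auto)
    have range: "(\<alpha> < 1/3) = True" "(1/3 \<le> \<alpha> \<and> \<alpha> \<le> 1/2) = False" "(1/2 < \<alpha>) = False" "\<alpha> \<le> 1/2"
      using 1 by auto
    note theta = theta_low[OF range(4)]
    show ?thesis
      unfolding range(1-3) simp_thms
      by (rule solution_decay[OF \<open>\<sigma> \<ge> 1\<close> s0 sum \<open>0 \<le> \<kappa>\<close> \<open>\<kappa> \<le> 1\<close> theta(2) theta(1)[symmetric]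
            less_imp_le[OF K(1)] powr_ge_zero K(2)])
  next
    case 2
    have range: "(\<alpha> < 1/3) = False" "(1/3 \<le> \<alpha> \<and> \<alpha> \<le> 1/2) = True" "(1/2 < \<alpha>) = False"
      using 2 by auto
    note theta = theta_low[OF 2(2)]
    show ?thesis
      unfolding range simp_thms
      by (rule solution_decay[OF \<open>\<sigma> \<ge> 1\<close> s0 \<open>s0 \<le> s\<close> \<open>0 \<le> \<kappa>\<close> \<open>\<kappa> \<le> 1\<close> theta(2) theta(1)[symmetric]
            _ exp_ge_zero high_frequency_exponential[where \<alpha> = \<alpha>]])
        (use 2 s0 assms in auto)
  next
    case 3
    have range: "(\<alpha> < 1/3) = False" "(1/3 \<le> \<alpha> \<and> \<alpha> \<le> 1/2) = False" "(1/2 < \<alpha>) = True"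
      using 3 by auto
    note theta = theta_high[OF 3]
    show ?thesis
      unfolding range simp_thms
      by (rule solution_decay[OF \<open>\<sigma> \<ge> 1\<close> s0 \<open>s0 \<le> s\<close> \<open>0 \<le> \<kappa>\<close> \<open>\<kappa> \<le> 1\<close> theta(2) theta(1)[symmetric]
            _ exp_ge_zero high_frequency_exponential[where \<alpha> = \<alpha>]])
        (use 3 s0 assms in auto)
  qed
qed

end
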